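(* Let $f$ be $(\delta_f,L_f)$-approximately smooth with components $(\bar f,\bar g)$, let $\|x-y\|\le D$ for all $x,y\in\operatorname{dom}\psi$ (where $D>0$), and let $\hat g$ be an unbiased stochastic oracle for $\bar g$ with $\sigma^2:=\sup_{x\in\operatorname{dom}\psi}\mathrm{Var}_{\hat g}(x)<+\infty$. Let UniversalSgd (defined in the context), with a stepsize update rule $M_+(\cdot)$ satisfying the requirement (R) of the context with constants $c_1,c_2,c_3,c_4>0$, be run for $N\ge1$ iterations from a point $x_0\in\operatorname{dom}\psi$ with $M_0=0$ and diameter parameter $D$. Then, for the point $\bar x_N$ generated by the algorithm, $$\mathbb E[F(\bar x_N)]-F^*\le \frac{c_2c_4L_fD^2}{N}+2\sigma D\sqrt{\frac{2c_1c_4}{N}}+c_3\delta_f .$$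
   Context: Space: $\mathbb R^d$ with standard inner product $\langle\cdot,\cdot\rangle$, norm $\|x\|=\langle Bx,x\rangle^{1/2}$ ($B$ a fixed positive definite matrix), dual norm $\|s\|_*=\max_{\|x\|=1}\langle s,x\rangle=\langle s,B^{-1}s\rangle^{1/2}$. $[t]_+=\max\{t,0\}$. Problem: $F^*=\min_{x\in\operatorname{dom}\psi}[F(x):=f(x)+\psi(x)]$, where $f:\mathbb R^d\to\mathbb R$ is convex, $\psi:\mathbb R^d\to\mathbb R\cup\{+\infty\}$ is proper closed convex, $\operatorname{dom}\psi=\{x:\psi(x)<+\infty\}$; a solution $x^*$ is assumed to exist. Approximate smoothness: $f$ is $(\delta_f,L_f)$-approximately smooth ($\delta_f,L_f\ge0$) with components $\bar f:\mathbb R^d\to\mathbb R$, $\bar g:\mathbb R^d\to\mathbb R^d$ if $\beta(x,y):=f(y)-\bar f(x)-\langle\bar g(x),y-x\rangle$ satisfies $0\le\beta(x,y)\le\frac{L_f}{2}\|x-y\|^2+\delta_f$ for all $x,y\in\mathbb R^d$. Stochastic oracle: $\hat g=(g,\xi)$ is a random variable $\xi$ with a mapping $g$; a query at $x$ generates an independent copy of $\xi$ and returns $g(x,\xi)$. It is unbiased for $\bar g$ if $\mathbb E_\xi[g(x,\xi)]=\bar g(x)$ for all $x$. $\mathrm{Var}_{\hat g}(x)=\mathbb E_\xi[\|g(x,\xi)-\bar g(x)\|_*^2]$. Proximal map: $\mathrm{Prox}_\psi(x,g,M)=\operatorname{argmin}_{y\in\operatorname{dom}\psi}\{\langle g,y\rangle+\psi(y)+\frac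 M2\|y-x\|^2\}$, $M\ge 0$ (if $M=0$, any minimizer may be chosen). Requirement (R) on the stepsize update rule $M_+(\cdot)$, with (absolute) constants $c_1,\dots,c_4>0$: given the current stepsize coefficient $M\ge0$, a constant $\Omega>0$, the current point $x\in\operatorname{dom}\psi$ with the stochastic gradient $\hat g_x$ (the output of a query of $\hat g$ at $x$), and the next random point $\hat x_+\in\operatorname{dom}\psi$ (possibly dependent on $\hat g_x$) with the stochastic gradient $\hat g_{x_+}$ (the output of a query of $\hat g$ at $\hat x_+$), the rule computes $\hat M_+=M_+(M,\Omega,x,\hat x_+,\hat g_x,\hat g_{x_+})$ such that $\hat M_+\ge M$ and, for any $\bar M>c_2L_f$, $$\mathbb E[\hat\Delta(\hat M_+)+(\hat M_+-M)\Omega+\beta(\hat x_+,x)]\le\frac{c_1}{\bar M-c_2L_f}\mathbb E[\mathrm{Var}_{\hat g}(\hat x_+)+\mathrm{Var}_{\hat g}(x)]+c_3\delta_f+c_4\mathbb E\{[\min\{\hat M_+,\bar M\}-M]_+\Omega\},$$ where $\hat\Delta(\hat M_+)=\beta(x,\hat x_+)+\langle\bar g(x)-\hat g_x,\hat x_+-x\rangle-\frac{\hat M_+}{2}\|\hat x_+-x\|^2$ and the expectation is taken with respect to the entire randomness. (Main example: $\hat M_+=\sqrt{M^2+\frac1\Omega\|\hat g_{x_+}-\hat g_x\|_*^2}$, with $c_1=\frac52,c_2=4,c_3=6,c_4=2$.) UniversalSgd with oracle $\hat g$, inputs $x_0\in\operatorname{dom}\psi$, $M_0$, $N$, $D$: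 query $g_0$ from $\hat g$ at $x_0$; for $k=0,\dots,N-1$: $x_{k+1}=\mathrm{Prox}_\psi(x_k,g_k,M_k)$; query $g_{k+1}$ from $\hat g$ at $x_{k+1}$; $M_{k+1}=M_+(M_k,D^2,x_k,x_{k+1},g_k,g_{k+1})$. Output $(\bar x_N,x_N,M_N)$ with $\bar x_N=\frac1N\sum_{i=1}^Nx_i$. *)

theory Defs
  imports "HOL-Probability.Probability"
begin

definition pos_def_matrix :: "real^'n^'n \<Rightarrow> bool" where
  "pos_def_matrix B \<longleftrightarrow> transpose B = B \<and> (\<forall>x. x \<noteq> 0 \<longrightarrow> 0 < (B *v x) \<bullet> x)"

definition bnorm :: "real^'n^'n \<Rightarrow> real^'n \<Rightarrow> real" where
  "bnorm B x = sqrt ((B *v x) \<bullet> x)"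

definition dual_norm :: "real^'n^'n \<Rightarrow> real^'n \<Rightarrow> real" where
  "dual_norm B s = Sup {s \<bullet> x | x. bnorm B x = 1}"

definition edom :: "('a \<Rightarrow> ereal) \<Rightarrow> 'a set" where
  "edom \<psi> = {x. \<psi> x < \<infinity>}"

definition proper_closed_convex :: "(real^'n \<Rightarrow> ereal) \<Rightarrow> bool" where
  "proper_closed_convex \<psi> \<longleftrightarrow>
     (\<forall>x. \<psi> x \<noteq> -\<infinity>) \<and> edom \<psi> \<noteq> {} \<and>
     closed {(x, t :: real). \<psi> x \<le> ereal t} \<and>
     convex {(x, t :: real). \<psi> x \<le> ereal t}"

definition composite :: "(real^'n \<Rightarrow> real) \<Rightarrow> (real^'n \<Rightarrow> ereal) \<Rightarrow> real^'n \<Rightarrow> ereal" where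
  "composite f \<psi> x = ereal (f x) + \<psi> x"

definition lin_error ::
  "(real^'n \<Rightarrow> real) \<Rightarrow> (real^'n \<Rightarrow> real) \<Rightarrow> (real^'n \<Rightarrow> real^'n) \<Rightarrow> real^'n \<Rightarrow> real^'n \<Rightarrow> real" where
  "lin_error f fbar gbar x y = f y - fbar x - gbar x \<bullet> (y - x)"

definition approx_smooth ::
  "real^'n^'n \<Rightarrow> real \<Rightarrow> real \<Rightarrow> (real^'n \<Rightarrow> real) \<Rightarrow> (real^'n \<Rightarrow> real) \<Rightarrow> (real^'n \<Rightarrow> real^'n) \<Rightarrow> bool" where
  "approx_smooth B \<delta> L f fbar gbar \<longleftrightarrow> 0 \<le> \<delta> \<and> 0 \<le> L \<and>
     (\<forall>x y. 0 \<le> lin_error f fbar gbar x y \<and>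
            lin_error f fbar gbar x y \<le> L / 2 * (bnorm B (x - y))\<^sup>2 + \<delta>)"

definition prox :: "real^'n^'n \<Rightarrow> (real^'n \<Rightarrow> ereal) \<Rightarrow> real^'n \<Rightarrow> real^'n \<Rightarrow> real \<Rightarrow> (real^'n) set" where
  "prox B \<psi> x g m =
     {z. is_arg_min (\<lambda>y. ereal (g \<bullet> y) + \<psi> y + ereal (m / 2 * (bnorm B (y - x))\<^sup>2))
                    (\<lambda>y. y \<in> edom \<psi>) z}"

(* The extended expectation E[Z+] - E[Z-]; it agrees with the Bochner integral on integrable Z.
   Bochner integration alone would assign 0 to non-integrable Z.  Since infinity - infinity =
   infinity in ereal, an upper bound by a finite number also says that E[Z+] is finite. *)
definition ext_expectation :: "'a measure \<Rightarrow> ('a \<Rightarrow> ereal) \<Rightarrow> ereal" where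
  "ext_expectation W Z =
     enn2ereal (\<integral>\<^sup>+\<omega>. e2ennreal (Z \<omega>) \<partial>W) - enn2ereal (\<integral>\<^sup>+\<omega>. e2ennreal (- Z \<omega>) \<partial>W)"

(* An oracle is given by the law P of its random variable and the mapping g. *)
definition stoch_oracle :: "'s measure \<Rightarrow> (real^'n \<Rightarrow> 's \<Rightarrow> real^'n) \<Rightarrow> bool" where
  "stoch_oracle P g \<longleftrightarrow> prob_space P \<and> (\<lambda>(x, s). g x s) \<in> borel_measurable (borel \<Otimes>\<^sub>M P)"

definition unbiased :: "'s measure \<Rightarrow> (real^'n \<Rightarrow> 's \<Rightarrow> real^'n) \<Rightarrow> (real^'n \<Rightarrow> real^'n) \<Rightarrow> bool" where
  "unbiased P g gbar \<longleftrightarrow> (\<forall>x. integrable P (g x) \<and> (LINT s|P. g x s) = gbar x)"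

definition oracle_var ::
  "real^'n^'n \<Rightarrow> 's measure \<Rightarrow> (real^'n \<Rightarrow> 's \<Rightarrow> real^'n) \<Rightarrow> (real^'n \<Rightarrow> real^'n) \<Rightarrow> real^'n \<Rightarrow> ereal" where
  "oracle_var B P g gbar x = ext_expectation P (\<lambda>s. ereal ((dual_norm B (g x s - gbar x))\<^sup>2))"

(* Arguments of a stepsize rule: M, Omega, x, x+, g_x, g_x+. *)
type_synonym 'n stepsize_rule =
  "real \<Rightarrow> real \<Rightarrow> real^'n \<Rightarrow> real^'n \<Rightarrow> real^'n \<Rightarrow> real^'n \<Rightarrow> real"

definition stepsize_gap ::
  "real^'n^'n \<Rightarrow> (real^'n \<Rightarrow> real) \<Rightarrow> (real^'n \<Rightarrow> real) \<Rightarrow> (real^'n \<Rightarrow> real^'n)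
    \<Rightarrow> real^'n \<Rightarrow> real^'n \<Rightarrow> real^'n \<Rightarrow> real \<Rightarrow> real" where
  "stepsize_gap B f fbar gbar x y u m' =
     lin_error f fbar gbar x y + (gbar x - u) \<bullet> (y - x) - m' / 2 * (bnorm B (y - x))\<^sup>2"

(* Q is the joint law of (M, xi, x+), where g_x = g x xi; the sample t behind g_x+ is independent
   of that triple.  Letting Q range over all laws on this space whose xi-marginal is P lets x+ and
   M depend on g_x in an arbitrary way.  The dependence of M on g_x is essential: in the algorithm,
   M_k is itself computed from g_k.  The current point x can be fixed, since the sample used
   to query the oracle at x_k is independent of x_k. *)
definition stepsize_requirement ::
  "real^'n^'n \<Rightarrow> (real^'n \<Rightarrow> ereal) \<Rightarrow> (real^'n \<Rightarrow> real) \<Rightarrow> (real^'n \<Rightarrow> real) \<Rightarrow> (real^'n \<Rightarrow> real^'n)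
    \<Rightarrow> real \<Rightarrow> real \<Rightarrow> 's measure \<Rightarrow> (real^'n \<Rightarrow> 's \<Rightarrow> real^'n)
    \<Rightarrow> real \<Rightarrow> real \<Rightarrow> real \<Rightarrow> real \<Rightarrow> 'n stepsize_rule \<Rightarrow> bool" where
  "stepsize_requirement B \<psi> f fbar gbar \<delta> L P g c1 c2 c3 c4 upd \<longleftrightarrow>
     (\<forall>\<Omega>>0. (\<lambda>(m, x, y, u, v). upd m \<Omega> x y u v) \<in> borel_measurable borel) \<and>
     (\<forall>\<Omega>>0. \<forall>m\<ge>0. \<forall>x\<in>edom \<psi>. \<forall>y\<in>edom \<psi>. \<forall>s\<in>space P. \<forall>t\<in>space P.
        m \<le> upd m \<Omega> x y (g x s) (g y t)) \<and>
     (\<forall>\<Omega>>0. \<forall>x\<in>edom \<psi>. \<forall>Q :: (real \<times> 's \<times> (real^'n)) measure.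
        prob_space Q \<and> sets Q = sets (borel \<Otimes>\<^sub>M P \<Otimes>\<^sub>M borel) \<and>
        distr Q P (\<lambda>(m, s, y). s) = P \<and>
        (AE (m, s, y) in Q. 0 \<le> m \<and> y \<in> edom \<psi>) \<longrightarrow>
        (\<forall>Mbar > c2 * L.
           ext_expectation (Q \<Otimes>\<^sub>M P) (\<lambda>((m, s, y), t).
               let m' = upd m \<Omega> x y (g x s) (g y t)
               in ereal (stepsize_gap B f fbar gbar x y (g x s) m' + (m' - m) * \<Omega>
                         + lin_error f fbar gbar y x))
           \<le> ereal (c1 / (Mbar - c2 * L)) *
                ext_expectation Q (\<lambda>(m, s, y). oracle_var B P g gbar y + oracle_var B P g gbar x)
             + ereal (c3 * \<delta>)
             + ereal c4 * ext_expectation (Q \<Otimes>\<^sub>M P) (\<lambda>((m, s, y), t).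
                 let m' = upd m \<Omega> x y (g x s) (g y t)
                 in ereal (max 0 (min m' Mbar - m) * \<Omega>))))"

definition iid_samples :: "'w measure \<Rightarrow> 's measure \<Rightarrow> (nat \<Rightarrow> 'w \<Rightarrow> 's) \<Rightarrow> nat \<Rightarrow> bool" where
  "iid_samples W P \<xi> N \<longleftrightarrow> prob_space W \<and> prob_space.indep_vars W (\<lambda>_. P) \<xi> {..N} \<and>
     (\<forall>k\<le>N. distr W P (\<xi> k) = P)"

definition history :: "'w measure \<Rightarrow> 's measure \<Rightarrow> (nat \<Rightarrow> 'w \<Rightarrow> 's) \<Rightarrow> nat \<Rightarrow> 'w measure" where
  "history W P \<xi> k =
     vimage_algebra (space W) (\<lambda>\<omega>. \<lambda>i\<in>{..<k}. \<xi> i \<omega>) (PiM {..<k} (\<lambda>_. P))"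

(* X k and m k are the iterates and stepsize coefficients, and the k-th query returns
   g (X k) (xi k).  Minimizers in the proximal step need not be unique when m k = 0; any choice
   that is a measurable function of the samples drawn so far is allowed. *)
definition universal_sgd ::
  "real^'n^'n \<Rightarrow> (real^'n \<Rightarrow> ereal) \<Rightarrow> 's measure \<Rightarrow> (real^'n \<Rightarrow> 's \<Rightarrow> real^'n) \<Rightarrow> 'n stepsize_rule
    \<Rightarrow> 'w measure \<Rightarrow> (nat \<Rightarrow> 'w \<Rightarrow> 's) \<Rightarrow> real^'n \<Rightarrow> real \<Rightarrow> nat \<Rightarrow> real
    \<Rightarrow> (nat \<Rightarrow> 'w \<Rightarrow> real^'n) \<Rightarrow> (nat \<Rightarrow> 'w \<Rightarrow> real) \<Rightarrow> bool" where
  "universal_sgd B \<psi> P g upd W \<xi> x0 M0 N D X m \<longleftrightarrow>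
     iid_samples W P \<xi> N \<and>
     (\<forall>k\<le>N. X k \<in> borel_measurable (history W P \<xi> k)) \<and>
     (\<forall>\<omega>\<in>space W. X 0 \<omega> = x0 \<and> m 0 \<omega> = M0) \<and>
     (\<forall>k<N. \<forall>\<omega>\<in>space W.
        X (Suc k) \<omega> \<in> prox B \<psi> (X k \<omega>) (g (X k \<omega>) (\<xi> k \<omega>)) (m k \<omega>) \<and>
        m (Suc k) \<omega> = upd (m k \<omega>) (D\<^sup>2) (X k \<omega>) (X (Suc k) \<omega>)
                        (g (X k \<omega>) (\<xi> k \<omega>)) (g (X (Suc k) \<omega>) (\<xi> (Suc k) \<omega>)))"

definition avg_iterate :: "(nat \<Rightarrow> 'w \<Rightarrow> real^'n) \<Rightarrow> nat \<Rightarrow> 'w \<Rightarrow> real^'n" where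
  "avg_iterate X N \<omega> = (1 / real N) *\<^sub>R (\<Sum>i=1..N. X i \<omega>)"

end

(* Three-point inequality for the proximal step plus convexity bound the suboptimality of x_{k+1} by
   the left-hand side of the stepsize requirement, a zero-mean noise term and a telescoping term
   in M_k |x_k - x*|^2.  Summing, the truncated increments [min(M_{k+1}, Mbar) - M_k]_+ telescope
   to at most Mbar; dividing by N and minimizing over Mbar > c2 L gives the rate.

   fbar need not be measurable, so the left-hand side of the requirement is only ever used through
   measurable minorants (growth_gap and descent_gap below).  The first of them controls M_{k+1} - M_k
   and shows by induction that every M_k is integrable, which the telescoping needs. *)

theory Submission
  imports Defs
begin

section \<open>Primal and dual norms\<close>

text \<open>The requirement speaks of a deterministic current point, whereas \<open>X k\<close> is
  random and \<open>m k\<close> has already seen the sample \<open>\<xi> k\<close>. Each ingredient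
  of a step is therefore written as a function of \<open>past k\<close>, \<open>\<xi> k\<close> and
  \<open>\<xi> (Suc k)\<close>, whose joint law is a product. With the past held fixed the
  requirement applies, and Tonelli integrates the outcome over the past. At that stage nothing is
  known to be integrable, so the inequality is carried in the form "positive part \<le> bound +
  negative part" between nonnegative integrals. Bounding the negative part by something integrable
  then yields integrability of the whole and an inequality between ordinary expectations. The value
  \<Omega> = D^2 matches the cost of a step exactly: raising the coefficient from M_k to M_{k+1} in
  front of |x_{k+1} - x_k|^2 / 2 and of |x_{k+1} - x*|^2 / 2 costs at most (M_{k+1} - M_k) D^2 / 2
  each.\<close>

lemma continuous_on_bnorm: "continuous_on S (bnorm B)"
  unfolding bnorm_def by (intro continuous_intros matrix_vector_mult_linear_continuous_on)

lemma bnorm_minus: "bnorm B (- x) = bnorm B x"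
  using matrix_vector_mult_scaleR[of B "-1" x] by (simp add: bnorm_def)

context
  fixes B :: "real^'n^'n"
  assumes B: "pos_def_matrix B"
begin

lemma quad_nonneg: "0 \<le> (B *v x) \<bullet> x"
  using B by (cases "x = 0") (auto simp: pos_def_matrix_def less_imp_le)

lemma bnorm_nonneg: "0 \<le> bnorm B x"
  by (simp add: bnorm_def quad_nonneg)

lemma bnorm_sq: "(bnorm B x)\<^sup>2 = (B *v x) \<bullet> x"
  by (simp add: bnorm_def quad_nonneg)

lemma bnorm_pos: "x \<noteq> 0 \<Longrightarrow> 0 < bnorm B x"
  using B by (auto simp: pos_def_matrix_def bnorm_def)

lemma bnorm_scaleR: "bnorm B (c *\<^sub>R x) = \<bar>c\<bar> * bnorm B x"
proof -
  have "(B *v (c *\<^sub>R x)) \<bullet> (c *\<^sub>R x) = c\<^sup>2 * ((B *v x) \<bullet> x)"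
    by (simp add: matrix_vector_mult_scaleR power2_eq_square)
  then show ?thesis
    by (simp add: bnorm_def real_sqrt_mult)
qed

lemma matrix_inner_commute: "(B *v x) \<bullet> y = (B *v y) \<bullet> x"
  using B by (metis dot_lmul_matrix inner_commute pos_def_matrix_def transpose_matrix_vector)

text \<open>Expanding the squares and using the symmetry of \<open>B\<close> leaves exactly the last
  term as defect from linear interpolation. It is the source of the strong convexity used in
  \<open>prox_three_point\<close>.\<close>

lemma bnorm_convex_combination:
  "(bnorm B ((1 - t) *\<^sub>R a + t *\<^sub>R b))\<^sup>2
     = (1 - t) * (bnorm B a)\<^sup>2 + t * (bnorm B b)\<^sup>2 - t * (1 - t) * (bnorm B (b - a))\<^sup>2"
  using matrix_inner_commute[of b a]
  by (simp add: bnorm_sq matrix_vector_right_distrib matrix_vector_mult_diff_distrib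
      matrix_vector_mult_scaleR inner_add_left inner_add_right inner_diff_left inner_diff_right algebra_simps)

text \<open>The constant is the reciprocal of the minimum of \<open>bnorm B\<close> on the compact
  Euclidean unit sphere, which is attained and positive.\<close>

lemma norm_le_bnorm: obtains c where "c > 0" "\<And>x. norm x \<le> c * bnorm B x"
proof -
  obtain u :: "real^'n" where "norm u = 1" using vector_choose_size[of 1] by auto
  then have "sphere (0 :: real^'n) 1 \<noteq> {}" by auto
  then obtain a where a: "a \<in> sphere 0 1" "\<And>y. y \<in> sphere 0 1 \<Longrightarrow> bnorm B a \<le> bnorm B y"
    using continuous_attains_inf[OF compact_sphere _ continuous_on_bnorm, of 0 1 B] by blast
  then have pos: "bnorm B a > 0" by (intro bnorm_pos) auto
  have "norm x \<le> (1 / bnorm B a) * bnorm B x" for x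
  proof (cases "x = 0")
    case False
    have "bnorm B a \<le> bnorm B ((1 / norm x) *\<^sub>R x)" using False by (intro a) auto
    then show ?thesis using False pos by (simp add: bnorm_scaleR field_simps)
  qed (simp add: bnorm_def)
  then show ?thesis using pos by (intro that[of "1 / bnorm B a"]) auto
qed

text \<open>A real-valued \<open>Sup\<close> is informative only on a nonempty set that is bounded
  above; this bound is what gives \<open>dual_norm\<close> its meaning.\<close>

lemma bdd_above_dual_norm: "bdd_above {s \<bullet> x | x. bnorm B x = 1}"
proof -
  obtain c where c: "c > 0" "\<And>x. norm x \<le> c * bnorm B x" using norm_le_bnorm by blast
  have "s \<bullet> x \<le> norm s * c" if "bnorm B x = 1" for x
  proof -
    have "s \<bullet> x \<le> norm s * norm x" by (rule norm_cauchy_schwarz)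
    also have "\<dots> \<le> norm s * c" using c(2)[of x] that by (intro mult_left_mono) auto
    finally show ?thesis .
  qed
  then show ?thesis by (auto intro!: bdd_aboveI[of _ "norm s * c"])
qed

lemma inner_le_dual_norm: "s \<bullet> x \<le> dual_norm B s * bnorm B x"
proof (cases "x = 0")
  case False
  then have p: "bnorm B x > 0" by (rule bnorm_pos)
  have "s \<bullet> ((1 / bnorm B x) *\<^sub>R x) \<le> dual_norm B s"
    unfolding dual_norm_def using p
    by (intro cSup_upper bdd_above_dual_norm CollectI exI[of _ "(1 / bnorm B x) *\<^sub>R x"])
      (simp add: bnorm_scaleR)
  then show ?thesis using p by (simp add: field_simps)
qed (simp add: bnorm_def)

lemma abs_inner_le_dual_norm: "\<bar>s \<bullet> x\<bar> \<le> dual_norm B s * bnorm B x"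
  using inner_le_dual_norm[of s x] inner_le_dual_norm[of s "- x"] by (simp add: bnorm_minus)

lemma ex_bnorm_eq_1: "\<exists>x. bnorm B x = 1"
proof -
  obtain u :: "real^'n" where "norm u = 1" using vector_choose_size[of 1] by auto
  then have "bnorm B u > 0" by (intro bnorm_pos) auto
  then show ?thesis by (intro exI[of _ "(1 / bnorm B u) *\<^sub>R u"]) (simp add: bnorm_scaleR)
qed

lemma dual_norm_nonneg: "0 \<le> dual_norm B s"
proof -
  obtain x where "bnorm B x = 1" using ex_bnorm_eq_1 by blast
  then show ?thesis using abs_inner_le_dual_norm[of s x] by simp
qed

lemma dual_norm_le_iff: "dual_norm B s \<le> a \<longleftrightarrow> (\<forall>x. bnorm B x = 1 \<longrightarrow> s \<bullet> x \<le> a)"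
  unfolding dual_norm_def using ex_bnorm_eq_1
  by (subst cSup_le_iff[OF _ bdd_above_dual_norm]) auto

text \<open>The supremum runs over an uncountable set, so measurability is obtained from
  semicontinuity: each sublevel set is an intersection of closed half-spaces.\<close>

lemma borel_measurable_dual_norm: "dual_norm B \<in> borel_measurable borel"
proof (rule borel_measurableI_le)
  fix a
  have "{s. dual_norm B s \<le> a} = (\<Inter>x\<in>{x. bnorm B x = 1}. {s. s \<bullet> x \<le> a})"
    by (auto simp: dual_norm_le_iff)
  also have "closed \<dots>"
    by (intro closed_INT ballI closed_Collect_le continuous_intros)
  finally show "{s \<in> space borel. dual_norm B s \<le> a} \<in> sets borel" by simp
qed

end

section \<open>Extended expectations\<close>

text \<open>The nonnegative integral is monotone for arbitrary integrands, so positive and negative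
  parts can be compared even if one of the functions is not measurable. This is the gate through
  which the left-hand side of the requirement gets replaced by a minorant.\<close>

lemma ext_expectation_mono_AE:
  assumes "AE w in M. Y w \<le> Z w"
  shows "ext_expectation M Y \<le> ext_expectation M Z"
  unfolding ext_expectation_def
  using assms
  by (intro ereal_minus_mono iffD1[OF less_eq_ennreal.rep_eq] nn_integral_mono_AE)
     (auto elim!: eventually_mono intro!: e2ennreal_mono)

lemma ext_expectation_nonneg:
  assumes "\<And>w. 0 \<le> Z w"
  shows "ext_expectation M Z = enn2ereal (\<integral>\<^sup>+w. e2ennreal (Z w) \<partial>M)"
proof -
  have "e2ennreal (- Z w) = 0" for w
    using assms[of w] by (intro e2ennreal_neg) (simp add: ereal_uminus_le_0_iff)
  then show ?thesis by (simp add: ext_expectation_def zero_ennreal.rep_eq)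
qed

lemma ext_expectation_ereal:
  "ext_expectation M (\<lambda>w. ereal (Z w)) =
     enn2ereal (\<integral>\<^sup>+w. ennreal (Z w) \<partial>M) - enn2ereal (\<integral>\<^sup>+w. ennreal (- Z w) \<partial>M)"
  by (simp add: ext_expectation_def)

lemma ext_expectation_integral:
  assumes "integrable M Z"
  shows "ext_expectation M (\<lambda>w. ereal (Z w)) = ereal (integral\<^sup>L M Z)"
proof -
  have "(\<integral>\<^sup>+w. ennreal (Z w) \<partial>M) \<noteq> \<infinity>" "(\<integral>\<^sup>+w. ennreal (- Z w) \<partial>M) \<noteq> \<infinity>"
    using assms by (auto simp: real_integrable_def)
  then show ?thesis
    unfolding ext_expectation_ereal real_lebesgue_integral_def[OF assms]
    by (cases "\<integral>\<^sup>+w. ennreal (Z w) \<partial>M"; cases "\<integral>\<^sup>+w. ennreal (- Z w) \<partial>M") auto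
qed

text \<open>Moving the negative part to the other side is sound for infinite integrals too: if it is
  infinite the right-hand side is infinite, and otherwise the subtraction is an honest one. The
  convention that infinity minus infinity is infinity agrees with this.\<close>

lemma nn_integral_le_of_ext_expectation_le:
  assumes "ext_expectation M (\<lambda>w. ereal (Z w)) \<le> enn2ereal r"
  shows "(\<integral>\<^sup>+w. ennreal (Z w) \<partial>M) \<le> r + (\<integral>\<^sup>+w. ennreal (- Z w) \<partial>M)"
proof -
  let ?p = "\<integral>\<^sup>+w. ennreal (Z w) \<partial>M" and ?n = "\<integral>\<^sup>+w. ennreal (- Z w) \<partial>M"
  have "enn2ereal ?p \<le> enn2ereal (r + ?n)"
    using assms unfolding ext_expectation_ereal
    by (cases "?p"; cases "?n"; cases r) (auto simp: plus_ennreal.rep_eq split: if_splits)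
  then show ?thesis by (simp add: less_eq_ennreal.rep_eq)
qed

section \<open>Factorization of measurable functions\<close>

text \<open>The factor is rebuilt from its sublevel sets \<open>{f < q}\<close> for rational \<open>q\<close>.\<close>

lemma factor_through_vimage_algebra_real:
  fixes f :: "'w \<Rightarrow> real"
  assumes \<phi>: "\<phi> \<in> \<Omega> \<rightarrow> space M" and f: "f \<in> borel_measurable (vimage_algebra \<Omega> \<phi> M)"
  obtains h where "h \<in> borel_measurable M" "\<And>w. w \<in> \<Omega> \<Longrightarrow> f w = h (\<phi> w)"
proof -
  have "\<exists>A. A \<in> sets M \<and> {w \<in> \<Omega>. f w < q} = \<phi> -` A \<inter> \<Omega>" for q
  proof -
    have "{w \<in> space (vimage_algebra \<Omega> \<phi> M). f w < q} \<in> sets (vimage_algebra \<Omega> \<phi> M)"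
      using f by (simp only: borel_measurable_iff_less)
    then obtain A where "{w \<in> \<Omega>. f w < q} = \<phi> -` A \<inter> \<Omega>" "A \<in> sets M"
      unfolding sets_vimage_algebra2[OF \<phi>] by auto
    then show ?thesis by blast
  qed
  then have "\<exists>A. \<forall>q. A q \<in> sets M \<and> {w \<in> \<Omega>. f w < q} = \<phi> -` A q \<inter> \<Omega>" by (intro choice allI)
  then obtain A where A: "\<And>q. A q \<in> sets M" "\<And>q. {w \<in> \<Omega>. f w < q} = \<phi> -` A q \<inter> \<Omega>" by blast
  \<comment> \<open>Off the range of \<open>\<phi>\<close> the sets \<open>A q\<close> are
    arbitrary, so the infimum may be infinite there. Hence \<open>h\<close> takes extended real
    values and is turned into a real function only at the end.\<close>
  define h where "h y = (INF q\<in>\<rat>. if y \<in> A q then ereal q else \<infinity>)" for y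
  have [measurable]: "h \<in> borel_measurable M"
    unfolding h_def using A(1)
    by (intro borel_measurable_INF countable_rat measurable_If_set borel_measurable_const)
      (simp add: sets.Int_space_eq2)
  have "h (\<phi> w) = ereal (f w)" if w: "w \<in> \<Omega>" for w
  proof (rule antisym)
    have iff: "\<phi> w \<in> A q \<longleftrightarrow> f w < q" for q
    proof -
      have "\<phi> w \<in> A q \<longleftrightarrow> w \<in> \<phi> -` A q \<inter> \<Omega>" using w by simp
      also have "\<dots> \<longleftrightarrow> f w < q" unfolding A(2)[symmetric] using w by simp
      finally show ?thesis .
    qed
    show "h (\<phi> w) \<le> ereal (f w)"
    proof (rule ereal_le_epsilon2)
      fix e :: real assume "0 < e"
      then obtain q where q: "q \<in> \<rat>" "f w < q" "q < f w + e"
        using Rats_dense_in_real[of "f w" "f w + e"] by auto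
      have "h (\<phi> w) \<le> ereal q"
        unfolding h_def using q by (intro INF_lower2[of q]) (auto simp: iff)
      also have "\<dots> \<le> ereal (f w) + ereal e" using q by simp
      finally show "h (\<phi> w) \<le> ereal (f w) + ereal e" .
    qed
    show "ereal (f w) \<le> h (\<phi> w)"
      unfolding h_def by (intro INF_greatest) (auto simp: iff less_imp_le)
  qed
  then have "f w = real_of_ereal (h (\<phi> w))" if "w \<in> \<Omega>" for w using that by simp
  moreover have "(\<lambda>y. real_of_ereal (h y)) \<in> borel_measurable M" by measurable
  ultimately show ?thesis by (rule that[rotated])
qed

text \<open>The Doob-Dynkin lemma, applied to each coordinate. It turns adaptedness to
  \<open>history\<close> into an explicit dependence on the vector of past samples, which can then
  be frozen in an iterated integral.\<close>

lemma factor_through_vimage_algebra: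
  fixes f :: "'w \<Rightarrow> 'b::euclidean_space"
  assumes \<phi>: "\<phi> \<in> \<Omega> \<rightarrow> space M" and f: "f \<in> borel_measurable (vimage_algebra \<Omega> \<phi> M)"
  obtains h where "h \<in> borel_measurable M" "\<And>w. w \<in> \<Omega> \<Longrightarrow> f w = h (\<phi> w)"
proof -
  have "\<exists>h. h \<in> borel_measurable M \<and> (\<forall>w\<in>\<Omega>. f w \<bullet> b = h (\<phi> w))" for b
  proof -
    have "(\<lambda>w. f w \<bullet> b) \<in> borel_measurable (vimage_algebra \<Omega> \<phi> M)" using f by (intro borel_measurable_inner borel_measurable_const)
    then show ?thesis by (rule factor_through_vimage_algebra_real[OF \<phi>]) auto
  qed
  then have "\<exists>h. \<forall>b. h b \<in> borel_measurable M \<and> (\<forall>w\<in>\<Omega>. f w \<bullet> b = h b (\<phi> w))"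
    by (intro choice allI)
  then obtain h where h: "\<And>b. h b \<in> borel_measurable M" "\<And>b w. w \<in> \<Omega> \<Longrightarrow> f w \<bullet> b = h b (\<phi> w)"
    by blast
  have "f w = (\<Sum>b\<in>Basis. h b (\<phi> w) *\<^sub>R b)" if "w \<in> \<Omega>" for w
    by (simp only: h(2)[OF that, symmetric] euclidean_representation)
  moreover have "(\<lambda>y. \<Sum>b\<in>Basis. h b y *\<^sub>R b) \<in> borel_measurable M"
    by (intro borel_measurable_sum borel_measurable_scaleR borel_measurable_const h(1))
  ultimately show ?thesis by (rule that[rotated])
qed

section \<open>Proper closed convex functions and the proximal step\<close>

context
  fixes \<psi> :: "real^'n \<Rightarrow> ereal"
  assumes \<psi>: "proper_closed_convex \<psi>"
begin

lemma edom_real: "x \<in> edom \<psi> \<Longrightarrow> \<psi> x = ereal (real_of_ereal (\<psi> x))"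
  using \<psi> by (cases "\<psi> x") (auto simp: edom_def proper_closed_convex_def)

lemma edom_convex_combination:
  assumes "x \<in> edom \<psi>" "y \<in> edom \<psi>" "0 \<le> t" "t \<le> 1"
  shows "(1 - t) *\<^sub>R x + t *\<^sub>R y \<in> edom \<psi>"
    and "real_of_ereal (\<psi> ((1 - t) *\<^sub>R x + t *\<^sub>R y))
      \<le> (1 - t) * real_of_ereal (\<psi> x) + t * real_of_ereal (\<psi> y)"
proof -
  let ?z = "(1 - t) *\<^sub>R x + t *\<^sub>R y"
  let ?r = "(1 - t) * real_of_ereal (\<psi> x) + t * real_of_ereal (\<psi> y)"
  have "convex {(x, t :: real). \<psi> x \<le> ereal t}" using \<psi> by (simp add: proper_closed_convex_def)
  then have "(1 - t) *\<^sub>R (x, real_of_ereal (\<psi> x)) + t *\<^sub>R (y, real_of_ereal (\<psi> y)) \<in> {(x, t :: real). \<psi> x \<le> ereal t}"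
    using edom_real[OF assms(1)] edom_real[OF assms(2)] assms(3,4) by (intro convexD) auto
  then have le: "\<psi> ?z \<le> ereal ?r" by simp
  then show "?z \<in> edom \<psi>" using le_less_trans[OF le, of \<infinity>] by (simp add: edom_def)
  then show "real_of_ereal (\<psi> ?z) \<le> ?r" using le edom_real by (metis ereal_less_eq(3))
qed

lemma convex_edom: "convex (edom \<psi>)"
  unfolding convex_alt by (auto intro: edom_convex_combination)

lemma convex_on_edom: "convex_on (edom \<psi>) (\<lambda>x. real_of_ereal (\<psi> x))"
  by (rule convex_onI) (auto intro: edom_convex_combination convex_edom)

text \<open>Sublevel sets at real levels are horizontal slices of the closed epigraph, hence
  closed.\<close>

lemma borel_measurable_closed_function: "\<psi> \<in> borel_measurable borel"
proof -
  have *: "closed {x. \<psi> x \<le> ereal t}" for t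
  proof -
    have "closed ((\<lambda>x. (x, t)) -` {(x, t :: real). \<psi> x \<le> ereal t})"
      using \<psi> by (intro closed_vimage continuous_intros) (simp add: proper_closed_convex_def)
    then show ?thesis by (simp add: vimage_def)
  qed
  have "{x. \<psi> x \<le> a} \<in> sets borel" for a
  proof (cases a)
    case (real r)
    then show ?thesis using * by auto
  next
    case MInf
    then have "{x. \<psi> x \<le> a} = {}" using \<psi> by (auto simp: proper_closed_convex_def)
    then show ?thesis by simp
  qed auto
  then show ?thesis by (intro borel_measurableI_le) simp
qed

lemma sets_edom: "edom \<psi> \<in> sets borel"
proof -
  have "{x \<in> space borel. \<psi> x < \<infinity>} \<in> sets borel"
    using borel_measurable_closed_function by (intro borel_measurable_less) auto
  then show ?thesis by (simp add: edom_def)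
qed

text \<open>The objective of the proximal step is \<open>m\<close>-strongly convex, hence grows quadratically away
  from its minimizer.\<close>

lemma prox_three_point:
  assumes B: "pos_def_matrix B" and y: "y \<in> prox B \<psi> x u m" and z: "z \<in> edom \<psi>"
  shows "u \<bullet> y + real_of_ereal (\<psi> y) + m / 2 * (bnorm B (y - x))\<^sup>2 + m / 2 * (bnorm B (z - y))\<^sup>2
    \<le> u \<bullet> z + real_of_ereal (\<psi> z) + m / 2 * (bnorm B (z - x))\<^sup>2"
proof -
  define \<Phi> where "\<Phi> w = u \<bullet> w + real_of_ereal (\<psi> w) + m / 2 * (bnorm B (w - x))\<^sup>2" for w
  have yd: "y \<in> edom \<psi>" using y by (simp add: prox_def is_arg_min_def)
  have min: "\<Phi> y \<le> \<Phi> w" if w: "w \<in> edom \<psi>" for w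
  proof -
    have "\<not> ereal (u \<bullet> w) + \<psi> w + ereal (m / 2 * (bnorm B (w - x))\<^sup>2)
        < ereal (u \<bullet> y) + \<psi> y + ereal (m / 2 * (bnorm B (y - x))\<^sup>2)"
      using y w by (auto simp: prox_def is_arg_min_def)
    moreover obtain a b where "\<psi> y = ereal a" "\<psi> w = ereal b"
      using edom_real[OF yd] edom_real[OF w] by blast
    ultimately show ?thesis by (simp add: \<Phi>_def)
  qed
  let ?d = "m / 2 * (bnorm B (z - y))\<^sup>2"
  \<comment> \<open>Minimality of \<open>y\<close> is tested against the points of the segment
    towards \<open>z\<close>. Dividing by \<open>t\<close> leaves the factor \<open>1 - t\<close> on
    the quadratic gain, which the limit \<open>t\<close> to 0 removes.\<close>
  have "\<Phi> y + (1 - t) * ?d \<le> \<Phi> z" if t: "0 < t" "t < 1" for t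
  proof -
    let ?w = "(1 - t) *\<^sub>R y + t *\<^sub>R z"
    have "?w - x = (1 - t) *\<^sub>R (y - x) + t *\<^sub>R (z - x)" by (simp add: algebra_simps)
    then have "(bnorm B (?w - x))\<^sup>2 = (1 - t) * (bnorm B (y - x))\<^sup>2 + t * (bnorm B (z - x))\<^sup>2
        - t * (1 - t) * (bnorm B (z - y))\<^sup>2"
      using bnorm_convex_combination[OF B, of t "y - x" "z - x"] by simp
    moreover have "real_of_ereal (\<psi> ?w) \<le> (1 - t) * real_of_ereal (\<psi> y) + t * real_of_ereal (\<psi> z)"
      using t by (intro edom_convex_combination yd z) auto
    ultimately have "\<Phi> ?w \<le> u \<bullet> ?w + ((1 - t) * real_of_ereal (\<psi> y) + t * real_of_ereal (\<psi> z))
        + m / 2 * ((1 - t) * (bnorm B (y - x))\<^sup>2 + t * (bnorm B (z - x))\<^sup>2 - t * (1 - t) * (bnorm B (z - y))\<^sup>2)"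
      by (simp add: \<Phi>_def)
    also have "\<dots> = (1 - t) * \<Phi> y + t * \<Phi> z - t * (1 - t) * ?d"
      unfolding \<Phi>_def inner_add_right inner_scaleR_right by (simp add: field_simps)
    finally have "\<Phi> ?w \<le> (1 - t) * \<Phi> y + t * \<Phi> z - t * (1 - t) * ?d" .
    moreover have "\<Phi> y \<le> \<Phi> ?w" using t by (intro min edom_convex_combination yd z) auto
    ultimately have "t * (\<Phi> y + (1 - t) * ?d) \<le> t * \<Phi> z" by (simp add: algebra_simps)
    then show ?thesis using t(1) by (rule mult_left_le_imp_le)
  qed
  then have "\<forall>\<^sub>F t in at_right 0. \<Phi> y + (1 - t) * ?d \<le> \<Phi> z"
    by (intro eventually_at_rightI[of 0 1]) auto
  moreover have "((\<lambda>t. \<Phi> y + (1 - t) * ?d) \<longlongrightarrow> \<Phi> y + (1 - 0) * ?d) (at_right 0)"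
    by (intro tendsto_intros)
  ultimately have "\<Phi> y + (1 - 0) * ?d \<le> \<Phi> z"
    by (intro tendsto_upperbound) auto
  then show ?thesis by (simp add: \<Phi>_def)
qed

lemma composite_average_le:
  assumes f: "convex_on UNIV f" and N: "N \<ge> 1" and X: "\<And>i. i \<in> {1..N} \<Longrightarrow> X i w \<in> edom \<psi>"
  shows "composite f \<psi> (avg_iterate X N w)
    \<le> ereal ((\<Sum>i=1..N. f (X i w) + real_of_ereal (\<psi> (X i w))) / real N)"
proof -
  have avg: "avg_iterate X N w = (\<Sum>i=1..N. (1 / real N) *\<^sub>R X i w)"
    by (simp add: avg_iterate_def scaleR_sum_right)
  have wt: "(\<Sum>i=1..N. 1 / real N) = 1" using N by simp
  have dom: "avg_iterate X N w \<in> edom \<psi>"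
    unfolding avg using wt X by (intro convex_sum convex_edom) auto
  have "f (avg_iterate X N w) \<le> (\<Sum>i=1..N. (1 / real N) * f (X i w))"
    unfolding avg using wt N by (intro convex_on_sum[OF _ _ f]) auto
  moreover have "real_of_ereal (\<psi> (avg_iterate X N w)) \<le> (\<Sum>i=1..N. (1 / real N) * real_of_ereal (\<psi> (X i w)))"
    unfolding avg using wt N X by (intro convex_on_sum[OF _ _ convex_on_edom]) auto
  ultimately have "f (avg_iterate X N w) + real_of_ereal (\<psi> (avg_iterate X N w))
      \<le> (\<Sum>i=1..N. f (X i w) + real_of_ereal (\<psi> (X i w))) / real N"
    by (simp add: sum.distrib sum_divide_distrib add_divide_distrib)
  then show ?thesis
    unfolding composite_def by (subst edom_real[OF dom]) simp
qed

end

section \<open>The requirement at a fixed current point\<close>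

locale sgd_setting =
  fixes B :: "real^'n^'n"
    and f fbar :: "real^'n \<Rightarrow> real"
    and gbar :: "real^'n \<Rightarrow> real^'n"
    and \<psi> :: "real^'n \<Rightarrow> ereal"
    and P :: "'s measure"
    and g :: "real^'n \<Rightarrow> 's \<Rightarrow> real^'n"
    and upd :: "'n stepsize_rule"
    and xstar :: "real^'n"
    and \<delta> L D \<sigma> c1 c2 c3 c4 :: real
  assumes pos_def: "pos_def_matrix B"
    and convex_f: "convex_on UNIV f"
    and closed_psi: "proper_closed_convex \<psi>"
    and xstar: "is_arg_min (composite f \<psi>) (\<lambda>x. x \<in> edom \<psi>) xstar"
    and smooth: "approx_smooth B \<delta> L f fbar gbar"
    and D_pos: "D > 0"
    and diameter: "\<forall>x\<in>edom \<psi>. \<forall>y\<in>edom \<psi>. bnorm B (x - y) \<le> D"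
    and valid_oracle: "stoch_oracle P g"
    and unbiased: "unbiased P g gbar"
    and variance: "ereal (\<sigma>\<^sup>2) = (SUP x\<in>edom \<psi>. oracle_var B P g gbar x)"
    and c_pos: "c1 > 0" "c2 > 0" "c3 > 0" "c4 > 0"
    and requirement: "stepsize_requirement B \<psi> f fbar gbar \<delta> L P g c1 c2 c3 c4 upd"
begin

sublocale P: prob_space P
  using valid_oracle by (simp add: stoch_oracle_def)

abbreviation psi_real :: "real^'n \<Rightarrow> real" where
  "psi_real x \<equiv> real_of_ereal (\<psi> x)"

text \<open>All that is retained of the proximal step. Unlike membership in \<open>prox\<close>,
  which quantifies over every competitor, this is a visibly measurable condition, so it can be moved
  as an almost sure statement between the run and the product laws.\<close>

definition descent :: "real^'n \<Rightarrow> real \<Rightarrow> real^'n \<Rightarrow> real^'n \<Rightarrow> bool" where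
  "descent x m u y \<longleftrightarrow> 0 \<le> m \<and> y \<in> edom \<psi> \<and>
     u \<bullet> y + psi_real y + m / 2 * (bnorm B (y - x))\<^sup>2 + m / 2 * (bnorm B (xstar - y))\<^sup>2
       \<le> u \<bullet> xstar + psi_real xstar + m / 2 * (bnorm B (xstar - x))\<^sup>2"

definition next_step :: "real^'n \<Rightarrow> real \<Rightarrow> 's \<Rightarrow> real^'n \<Rightarrow> 's \<Rightarrow> real" where
  "next_step x m s y t = upd m (D\<^sup>2) x y (g x s) (g y t)"

definition req_lhs :: "real^'n \<Rightarrow> real \<Rightarrow> 's \<Rightarrow> real^'n \<Rightarrow> 's \<Rightarrow> real" where
  "req_lhs x m s y t = stepsize_gap B f fbar gbar x y (g x s) (next_step x m s y t)
     + (next_step x m s y t - m) * D\<^sup>2 + lin_error f fbar gbar y x"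

text \<open>The two variances are already replaced by their common bound, hence
  \<open>2 * \<sigma>\<^sup>2\<close>. The truncated increment stays under the integral, so that it
  can later be summed along each trajectory.\<close>

definition req_rhs :: "real \<Rightarrow> real^'n \<Rightarrow> real \<Rightarrow> 's \<Rightarrow> real^'n \<Rightarrow> 's \<Rightarrow> real" where
  "req_rhs Mbar x m s y t = c1 / (Mbar - c2 * L) * (2 * \<sigma>\<^sup>2) + c3 * \<delta>
     + c4 * (max 0 (min (next_step x m s y t) Mbar - m) * D\<^sup>2)"

lemma delta_nonneg: "0 \<le> \<delta>" and L_nonneg: "0 \<le> L"
  using smooth by (auto simp: approx_smooth_def)

lemma lin_error_nonneg: "0 \<le> lin_error f fbar gbar x y"
  using smooth by (auto simp: approx_smooth_def)

lemma xstar_edom: "xstar \<in> edom \<psi>"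
  using xstar by (simp add: is_arg_min_def)

lemma bnorm_diff_le: "x \<in> edom \<psi> \<Longrightarrow> y \<in> edom \<psi> \<Longrightarrow> bnorm B (x - y) \<le> D"
  using diameter by blast

lemma bnorm_diff_sq_le: "x \<in> edom \<psi> \<Longrightarrow> y \<in> edom \<psi> \<Longrightarrow> (bnorm B (x - y))\<^sup>2 \<le> D\<^sup>2"
  by (intro power_mono bnorm_diff_le bnorm_nonneg pos_def)

lemma oracle_var_le: "x \<in> edom \<psi> \<Longrightarrow> oracle_var B P g gbar x \<le> ereal (\<sigma>\<^sup>2)"
  unfolding variance by (rule SUP_upper)

lemma next_step_ge:
  "\<lbrakk>0 \<le> m; x \<in> edom \<psi>; y \<in> edom \<psi>; s \<in> space P; t \<in> space P\<rbrakk> \<Longrightarrow> m \<le> next_step x m s y t"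
  using requirement D_pos by (simp add: stepsize_requirement_def next_step_def)

lemma measurable_oracle [measurable (raw)]:
  assumes [measurable]: "a \<in> borel_measurable M" "b \<in> measurable M P"
  shows "(\<lambda>w. g (a w) (b w)) \<in> borel_measurable M"
proof -
  have "(\<lambda>(x, s). g x s) \<in> borel_measurable (borel \<Otimes>\<^sub>M P)" using valid_oracle by (simp add: stoch_oracle_def)
  from measurable_compose[OF _ this, of "\<lambda>w. (a w, b w)" M] show ?thesis by simp
qed

lemma measurable_next_step [measurable (raw)]:
  assumes [measurable]: "a \<in> borel_measurable M" "b \<in> borel_measurable M" "c \<in> measurable M P"
    "d \<in> borel_measurable M" "e \<in> measurable M P"
  shows "(\<lambda>w. next_step (a w) (b w) (c w) (d w) (e w)) \<in> borel_measurable M"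
proof -
  have "(\<lambda>(m, x, y, u, v). upd m (D\<^sup>2) x y u v) \<in> borel_measurable borel"
    using requirement D_pos by (simp add: stepsize_requirement_def)
  from measurable_compose[OF _ this, of "\<lambda>w. (b w, a w, d w, g (a w) (c w), g (d w) (e w))" M]
  show ?thesis by (simp add: next_step_def borel_prod[symmetric])
qed

lemma borel_measurable_f [measurable]: "f \<in> borel_measurable borel"
  using convex_on_continuous[OF open_UNIV convex_f] by (rule borel_measurable_continuous_onI)

lemma borel_measurable_psi [measurable]: "\<psi> \<in> borel_measurable borel"
  by (rule borel_measurable_closed_function[OF closed_psi])

lemma edom_measurable [measurable]: "edom \<psi> \<in> sets borel"
  by (rule sets_edom[OF closed_psi])

lemma borel_measurable_bnorm [measurable]: "bnorm B \<in> borel_measurable borel"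
  by (intro borel_measurable_continuous_onI continuous_on_bnorm)

text \<open>Unbiasedness exhibits \<open>gbar\<close> as a parameter integral of the jointly
  measurable oracle.\<close>

lemma borel_measurable_gbar [measurable]: "gbar \<in> borel_measurable borel"
proof -
  have "gbar = (\<lambda>x. LINT s|P. g x s)" using unbiased by (simp add: unbiased_def fun_eq_iff)
  moreover have "(\<lambda>x. LINT s|P. g x s) \<in> borel_measurable borel" by measurable
  ultimately show ?thesis by simp
qed

lemma borel_measurable_dual_norm' [measurable]: "dual_norm B \<in> borel_measurable borel"
  by (rule borel_measurable_dual_norm[OF pos_def])

lemma measurable_descent [measurable (raw)]:
  assumes [measurable]: "a \<in> borel_measurable M" "b \<in> borel_measurable M"
    "c \<in> borel_measurable M" "d \<in> borel_measurable M"
  shows "Measurable.pred M (\<lambda>w. descent (a w) (b w) (c w) (d w))"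
proof -
  have [measurable]: "(\<lambda>w. bnorm B (d w - a w)) \<in> borel_measurable M"
    "(\<lambda>w. bnorm B (xstar - d w)) \<in> borel_measurable M"
    "(\<lambda>w. bnorm B (xstar - a w)) \<in> borel_measurable M"
    "(\<lambda>w. psi_real (d w)) \<in> borel_measurable M"
    "(\<lambda>w. c w \<bullet> d w) \<in> borel_measurable M"
    "(\<lambda>w. c w \<bullet> xstar) \<in> borel_measurable M"
    by (auto intro!: measurable_compose[OF _ borel_measurable_bnorm] measurable_compose[OF _ borel_measurable_psi])
  have "Measurable.pred M (\<lambda>w. d w \<in> edom \<psi>)"
    by (rule pred_sets2[OF edom_measurable]) fact
  moreover have "Measurable.pred M (\<lambda>w. c w \<bullet> d w + psi_real (d w) + b w / 2 * (bnorm B (d w - a w))\<^sup>2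
      + b w / 2 * (bnorm B (xstar - d w))\<^sup>2
      \<le> c w \<bullet> xstar + psi_real xstar + b w / 2 * (bnorm B (xstar - a w))\<^sup>2)"
    unfolding pred_def by (intro borel_measurable_le) measurable
  moreover have "Measurable.pred M (\<lambda>w. 0 \<le> b w)"
    unfolding pred_def by (intro borel_measurable_le) measurable
  ultimately show ?thesis
    unfolding descent_def by (intro pred_intros_logic)
qed

lemma measurable_req_rhs [measurable (raw)]:
  assumes [measurable]: "a \<in> borel_measurable M" "b \<in> borel_measurable M" "c \<in> measurable M P"
    "d \<in> borel_measurable M" "e \<in> measurable M P"
  shows "(\<lambda>w. req_rhs Mbar (a w) (b w) (c w) (d w) (e w)) \<in> borel_measurable M"
  unfolding req_rhs_def by measurable

lemma req_rhs_nonneg: "Mbar > c2 * L \<Longrightarrow> 0 \<le> req_rhs Mbar x m s y t"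
  unfolding req_rhs_def using c_pos delta_nonneg
  by (intro add_nonneg_nonneg mult_nonneg_nonneg) auto

lemma requirement_at_point:
  fixes Y :: "'s \<Rightarrow> real^'n" and \<gamma> :: "real \<Rightarrow> 's \<Rightarrow> real^'n \<Rightarrow> 's \<Rightarrow> real"
  assumes x: "x \<in> edom \<psi>"
    and C[measurable]: "C \<in> borel_measurable P" and Y[measurable]: "Y \<in> borel_measurable P"
    and descent: "AE s in P. descent x (C s) (g x s) (Y s)"
    and Mbar: "Mbar > c2 * L"
    and \<gamma>: "(\<lambda>((m, s, y), t). \<gamma> m s y t) \<in> borel_measurable ((borel \<Otimes>\<^sub>M P \<Otimes>\<^sub>M borel) \<Otimes>\<^sub>M P)"
    and le: "\<And>m s y t. \<lbrakk>s \<in> space P; t \<in> space P; descent x m (g x s) y\<rbrakk> \<Longrightarrow> \<gamma> m s y t \<le> req_lhs x m s y t"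
  shows "(\<integral>\<^sup>+(s, t). ennreal (\<gamma> (C s) s (Y s) t) \<partial>(P \<Otimes>\<^sub>M P))
    \<le> (\<integral>\<^sup>+(s, t). ennreal (req_rhs Mbar x (C s) s (Y s) t) \<partial>(P \<Otimes>\<^sub>M P))
      + (\<integral>\<^sup>+(s, t). ennreal (- \<gamma> (C s) s (Y s) t) \<partial>(P \<Otimes>\<^sub>M P))"
proof -
  note [measurable] = \<gamma>[unfolded case_prod_unfold]
  let ?N = "borel \<Otimes>\<^sub>M P \<Otimes>\<^sub>M (borel :: (real^'n) measure)"
  let ?h = "\<lambda>s. (C s, s, Y s)"
  let ?k = "\<lambda>(s, t). (?h s, t)"
  \<comment> \<open>The coefficient and the next point are deterministic functions of the sample
    here, since all earlier randomness is frozen.\<close>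
  define Q where "Q = distr P ?N ?h"
  have h[measurable]: "?h \<in> measurable P ?N" by measurable
  have setsQ[measurable_cong]: "sets Q = sets ?N" by (simp add: Q_def)
  interpret Q: prob_space Q unfolding Q_def by (rule P.prob_space_distr) measurable
  interpret PP: pair_prob_space P P ..
  interpret QP: pair_prob_space Q P ..
  have marginal: "distr Q P (\<lambda>(m, s, y). s) = P"
    unfolding Q_def by (subst distr_distr) (auto simp: comp_def intro!: distr_id)
  have QP: "Q \<Otimes>\<^sub>M P = distr (P \<Otimes>\<^sub>M P) (?N \<Otimes>\<^sub>M P) ?k"
    using pair_measure_distr[of ?h P ?N "\<lambda>t. t" P P] P.prob_space_axioms
    by (simp add: Q_def distr_id prob_space_imp_sigma_finite)
  have nn_QP: "(\<integral>\<^sup>+z. F z \<partial>(Q \<Otimes>\<^sub>M P)) = (\<integral>\<^sup>+(s, t). F ((C s, s, Y s), t) \<partial>(P \<Otimes>\<^sub>M P))"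
    if "F \<in> borel_measurable (?N \<Otimes>\<^sub>M P)" for F :: "_ \<Rightarrow> ennreal"
    unfolding QP using that by (subst nn_integral_distr) (auto simp: case_prod_unfold)
  have AEQ: "AE (m, s, y) in Q. descent x m (g x s) y"
    unfolding Q_def
  proof (subst AE_distr_iff)
    show "AE s in P. case ?h s of (m, s, y) \<Rightarrow> descent x m (g x s) y" using descent by simp
  qed measurable
  have AEQP: "AE z in Q \<Otimes>\<^sub>M P. case z of ((m, s, y), t) \<Rightarrow> descent x m (g x s) y"
  proof -
    have "AE z in distr (Q \<Otimes>\<^sub>M P) Q fst. case z of (m, s, y) \<Rightarrow> descent x m (g x s) y"
      using AEQ by (simp only: P.distr_pair_fst)
    from AE_distrD[OF measurable_fst this] show ?thesis by (simp add: case_prod_beta)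
  qed
  let ?lhs = "ext_expectation (Q \<Otimes>\<^sub>M P) (\<lambda>((m, s, y), t).
               let m' = upd m (D\<^sup>2) x y (g x s) (g y t)
               in ereal (stepsize_gap B f fbar gbar x y (g x s) m' + (m' - m) * D\<^sup>2
                         + lin_error f fbar gbar y x))"
  let ?var = "ext_expectation Q (\<lambda>(m, s, y). oracle_var B P g gbar y + oracle_var B P g gbar x)"
  let ?inc = "ext_expectation (Q \<Otimes>\<^sub>M P) (\<lambda>((m, s, y), t).
                 let m' = upd m (D\<^sup>2) x y (g x s) (g y t)
                 in ereal (max 0 (min m' Mbar - m) * D\<^sup>2))"
  let ?I = "\<integral>\<^sup>+(s, t). ennreal (max 0 (min (next_step x (C s) s (Y s) t) Mbar - C s) * D\<^sup>2) \<partial>(P \<Otimes>\<^sub>M P)"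
  have "?lhs \<le> ereal (c1 / (Mbar - c2 * L)) * ?var + ereal (c3 * \<delta>) + ereal c4 * ?inc"
  proof -
    have "AE (m, s, y) in Q. 0 \<le> m \<and> y \<in> edom \<psi>"
      using AEQ by eventually_elim (auto simp: descent_def)
    moreover have "0 < D\<^sup>2" using D_pos by simp
    ultimately show ?thesis
      using requirement[unfolded stepsize_requirement_def, THEN conjunct2, THEN conjunct2,
          rule_format, of "D\<^sup>2" x Q Mbar] x marginal setsQ Q.prob_space_axioms Mbar
      by simp
  qed
  also have "\<dots> \<le> ereal (c1 / (Mbar - c2 * L)) * ereal (2 * \<sigma>\<^sup>2) + ereal (c3 * \<delta>) + ereal c4 * ?inc"
  proof -
    have "?var \<le> ext_expectation Q (\<lambda>_. ereal (2 * \<sigma>\<^sup>2))"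
    proof (rule ext_expectation_mono_AE)
      show "AE w in Q. (\<lambda>(m, s, y). oracle_var B P g gbar y + oracle_var B P g gbar x) w \<le> ereal (2 * \<sigma>\<^sup>2)"
        using AEQ
      proof eventually_elim
        case (elim w)
        obtain m s y where w: "w = (m, s, y)" by (cases w) auto
        have "oracle_var B P g gbar y + oracle_var B P g gbar x \<le> ereal (\<sigma>\<^sup>2) + ereal (\<sigma>\<^sup>2)"
          using elim x by (intro add_mono oracle_var_le) (auto simp: w descent_def)
        then show ?case by (simp add: w)
      qed
    qed
    also have "\<dots> = ereal (2 * \<sigma>\<^sup>2)" by (subst ext_expectation_integral) (auto simp: Q.prob_space)
    finally show ?thesis using Mbar c_pos by (intro add_mono order_refl ereal_mult_left_mono) auto
  qed
  also have "?inc = enn2ereal ?I"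
  proof -
    have "?inc = enn2ereal (\<integral>\<^sup>+((m, s, y), t). ennreal (max 0 (min (next_step x m s y t) Mbar - m) * D\<^sup>2) \<partial>(Q \<Otimes>\<^sub>M P))"
      by (subst ext_expectation_nonneg) (auto simp: Let_def next_step_def case_prod_unfold)
    also have "\<dots> = enn2ereal ?I"
      by (subst nn_QP) (simp_all add: case_prod_unfold)
    finally show ?thesis .
  qed
  \<comment> \<open>All coefficients are nonnegative because \<open>Mbar\<close> exceeds
    \<open>c2 * L\<close>. The sum therefore lives in the nonnegative extended reals and can be
    absorbed into one integral.\<close>
  also have "ereal (c1 / (Mbar - c2 * L)) * ereal (2 * \<sigma>\<^sup>2) + ereal (c3 * \<delta>) + ereal c4 * enn2ereal ?I
      = enn2ereal (ennreal (c1 / (Mbar - c2 * L) * (2 * \<sigma>\<^sup>2) + c3 * \<delta>) + ennreal c4 * ?I)"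
    using Mbar c_pos delta_nonneg
    by (simp add: plus_ennreal.rep_eq times_ennreal.rep_eq enn2ereal_ennreal)
  also have "ennreal (c1 / (Mbar - c2 * L) * (2 * \<sigma>\<^sup>2) + c3 * \<delta>) + ennreal c4 * ?I
      = (\<integral>\<^sup>+(s, t). ennreal (req_rhs Mbar x (C s) s (Y s) t) \<partial>(P \<Otimes>\<^sub>M P))"
  proof -
    have "ennreal (req_rhs Mbar x m s y t) = ennreal (c1 / (Mbar - c2 * L) * (2 * \<sigma>\<^sup>2) + c3 * \<delta>)
        + ennreal c4 * ennreal (max 0 (min (next_step x m s y t) Mbar - m) * D\<^sup>2)" for m s y t
      unfolding req_rhs_def using Mbar c_pos delta_nonneg
      by (subst ennreal_plus) (auto simp: ennreal_mult')
    then show ?thesis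
      by (simp add: case_prod_unfold nn_integral_add nn_integral_cmult PP.emeasure_space_1)
  qed
  finally have lhs_le: "?lhs \<le> enn2ereal (\<integral>\<^sup>+(s, t). ennreal (req_rhs Mbar x (C s) s (Y s) t) \<partial>(P \<Otimes>\<^sub>M P))" .
  \<comment> \<open>Only here is the original integrand of the requirement compared with
    \<open>\<gamma>\<close>. The comparison holds almost everywhere, because \<open>descent\<close>
    is an almost sure property under \<open>Q\<close>.\<close>
  have "ext_expectation (Q \<Otimes>\<^sub>M P) (\<lambda>z. ereal (case z of ((m, s, y), t) \<Rightarrow> \<gamma> m s y t)) \<le> ?lhs"
  proof (rule ext_expectation_mono_AE)
    show "AE z in Q \<Otimes>\<^sub>M P. ereal (case z of ((m, s, y), t) \<Rightarrow> \<gamma> m s y t)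
        \<le> (\<lambda>((m, s, y), t). let m' = upd m (D\<^sup>2) x y (g x s) (g y t)
               in ereal (stepsize_gap B f fbar gbar x y (g x s) m' + (m' - m) * D\<^sup>2
                         + lin_error f fbar gbar y x)) z"
      using AEQP AE_space
    proof eventually_elim
      case (elim z)
      obtain m s y t where z: "z = ((m, s, y), t)" by (cases z) auto
      have "s \<in> space P" "t \<in> space P"
        using elim(2) sets_eq_imp_space_eq[OF setsQ] by (auto simp: z space_pair_measure)
      then show ?case using le[of s t m y] elim(1) by (simp add: z req_lhs_def next_step_def Let_def)
    qed
  qed
  from order_trans[OF this lhs_le]
  have "(\<integral>\<^sup>+z. ennreal (case z of ((m, s, y), t) \<Rightarrow> \<gamma> m s y t) \<partial>(Q \<Otimes>\<^sub>M P))
      \<le> (\<integral>\<^sup>+(s, t). ennreal (req_rhs Mbar x (C s) s (Y s) t) \<partial>(P \<Otimes>\<^sub>M P))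
       + (\<integral>\<^sup>+z. ennreal (- (case z of ((m, s, y), t) \<Rightarrow> \<gamma> m s y t)) \<partial>(Q \<Otimes>\<^sub>M P))"
    by (rule nn_integral_le_of_ext_expectation_le)
  moreover have "(\<integral>\<^sup>+z. ennreal (case z of ((m, s, y), t) \<Rightarrow> \<gamma> m s y t) \<partial>(Q \<Otimes>\<^sub>M P))
      = (\<integral>\<^sup>+(s, t). ennreal (\<gamma> (C s) s (Y s) t) \<partial>(P \<Otimes>\<^sub>M P))"
    by (subst nn_QP) (auto simp: case_prod_unfold)
  moreover have "(\<integral>\<^sup>+z. ennreal (- (case z of ((m, s, y), t) \<Rightarrow> \<gamma> m s y t)) \<partial>(Q \<Otimes>\<^sub>M P))
      = (\<integral>\<^sup>+(s, t). ennreal (- \<gamma> (C s) s (Y s) t) \<partial>(P \<Otimes>\<^sub>M P))"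
    by (subst nn_QP) (auto simp: case_prod_unfold)
  ultimately show ?thesis by simp
qed

end

text \<open>Tonelli twice, regrouped so that the two samples of one step form the inner integral at
  a fixed past \<open>h\<close>.\<close>

lemma nn_integral_pair_assoc:
  assumes P: "prob_space P" and F[measurable]: "F \<in> borel_measurable ((M \<Otimes>\<^sub>M P) \<Otimes>\<^sub>M P)"
  shows "(\<integral>\<^sup>+z. F z \<partial>((M \<Otimes>\<^sub>M P) \<Otimes>\<^sub>M P)) = (\<integral>\<^sup>+h. (\<integral>\<^sup>+(s, t). F ((h, s), t) \<partial>(P \<Otimes>\<^sub>M P)) \<partial>M)"
proof -
  interpret prob_space P by fact
  have "(\<integral>\<^sup>+z. F z \<partial>((M \<Otimes>\<^sub>M P) \<Otimes>\<^sub>M P)) = (\<integral>\<^sup>+z. (\<integral>\<^sup>+t. F (z, t) \<partial>P) \<partial>(M \<Otimes>\<^sub>M P))"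
    by (rule nn_integral_fst[symmetric]) measurable
  also have "\<dots> = (\<integral>\<^sup>+h. (\<integral>\<^sup>+s. (\<integral>\<^sup>+t. F ((h, s), t) \<partial>P) \<partial>P) \<partial>M)"
    by (rule nn_integral_fst[symmetric]) measurable
  also have "\<dots> = (\<integral>\<^sup>+h. (\<integral>\<^sup>+z. F ((h, fst z), snd z) \<partial>(P \<Otimes>\<^sub>M P)) \<partial>M)"
  proof (rule nn_integral_cong)
    fix h assume [measurable]: "h \<in> space M"
    show "(\<integral>\<^sup>+s. (\<integral>\<^sup>+t. F ((h, s), t) \<partial>P) \<partial>P) = (\<integral>\<^sup>+z. F ((h, fst z), snd z) \<partial>(P \<Otimes>\<^sub>M P))"
      using nn_integral_fst[of "\<lambda>z. F ((h, fst z), snd z)" P] by simp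
  qed
  finally show ?thesis by (simp add: case_prod_unfold)
qed

context sgd_setting
begin

text \<open>For almost every past \<open>h\<close> the point \<open>A h\<close> is a constant and
  \<open>requirement_at_point\<close> applies. All three terms are nonnegative integrals, so
  integrating over \<open>h\<close> preserves the inequality without any integrability.\<close>

lemma requirement_average:
  fixes \<mu> :: "'h measure" and A :: "'h \<Rightarrow> real^'n" and Y :: "'h \<times> 's \<Rightarrow> real^'n"
    and \<gamma> :: "real^'n \<Rightarrow> real \<Rightarrow> 's \<Rightarrow> real^'n \<Rightarrow> 's \<Rightarrow> real"
  assumes \<mu>: "prob_space \<mu>"
    and [measurable]: "A \<in> borel_measurable \<mu>" "C \<in> borel_measurable (\<mu> \<Otimes>\<^sub>M P)" "Y \<in> borel_measurable (\<mu> \<Otimes>\<^sub>M P)"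
    and descent: "AE z in \<mu> \<Otimes>\<^sub>M P. A (fst z) \<in> edom \<psi> \<and> descent (A (fst z)) (C z) (g (A (fst z)) (snd z)) (Y z)"
    and Mbar: "Mbar > c2 * L"
    and \<gamma>: "(\<lambda>(x, m, s, y, t). \<gamma> x m s y t) \<in> borel_measurable (borel \<Otimes>\<^sub>M borel \<Otimes>\<^sub>M P \<Otimes>\<^sub>M borel \<Otimes>\<^sub>M P)"
    and le: "\<And>x m s y t. \<lbrakk>x \<in> edom \<psi>; s \<in> space P; t \<in> space P; descent x m (g x s) y\<rbrakk>
      \<Longrightarrow> \<gamma> x m s y t \<le> req_lhs x m s y t"
  shows "(\<integral>\<^sup>+z. ennreal (\<gamma> (A (fst (fst z))) (C (fst z)) (snd (fst z)) (Y (fst z)) (snd z)) \<partial>((\<mu> \<Otimes>\<^sub>M P) \<Otimes>\<^sub>M P))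
    \<le> (\<integral>\<^sup>+z. ennreal (req_rhs Mbar (A (fst (fst z))) (C (fst z)) (snd (fst z)) (Y (fst z)) (snd z)) \<partial>((\<mu> \<Otimes>\<^sub>M P) \<Otimes>\<^sub>M P))
      + (\<integral>\<^sup>+z. ennreal (- \<gamma> (A (fst (fst z))) (C (fst z)) (snd (fst z)) (Y (fst z)) (snd z)) \<partial>((\<mu> \<Otimes>\<^sub>M P) \<Otimes>\<^sub>M P))"
proof -
  interpret \<mu>: prob_space \<mu> by fact
  interpret \<mu>P: pair_prob_space \<mu> P ..
  interpret PP: pair_prob_space P P ..
  let ?F = "\<lambda>z. ennreal (\<gamma> (A (fst (fst z))) (C (fst z)) (snd (fst z)) (Y (fst z)) (snd z))"
  let ?G = "\<lambda>z. ennreal (req_rhs Mbar (A (fst (fst z))) (C (fst z)) (snd (fst z)) (Y (fst z)) (snd z))"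
  let ?H = "\<lambda>z. ennreal (- \<gamma> (A (fst (fst z))) (C (fst z)) (snd (fst z)) (Y (fst z)) (snd z))"
  have [measurable]: "(\<lambda>z. \<gamma> (A (fst (fst z))) (C (fst z)) (snd (fst z)) (Y (fst z)) (snd z))
      \<in> borel_measurable ((\<mu> \<Otimes>\<^sub>M P) \<Otimes>\<^sub>M P)"
    using measurable_compose[OF _ \<gamma>, of "\<lambda>z. (A (fst (fst z)), C (fst z), snd (fst z), Y (fst z), snd z)"
        "(\<mu> \<Otimes>\<^sub>M P) \<Otimes>\<^sub>M P"] by simp
  have [measurable]: "(\<lambda>w. \<gamma> (A (fst w)) (C (fst w, fst (snd w))) (fst (snd w)) (Y (fst w, fst (snd w))) (snd (snd w)))
      \<in> borel_measurable (\<mu> \<Otimes>\<^sub>M P \<Otimes>\<^sub>M P)"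
    using measurable_compose[OF _ \<gamma>, of "\<lambda>w. (A (fst w), C (fst w, fst (snd w)), fst (snd w), Y (fst w, fst (snd w)), snd (snd w))"
        "\<mu> \<Otimes>\<^sub>M P \<Otimes>\<^sub>M P"] by simp
  have "(\<integral>\<^sup>+(s, t). ?F ((h, s), t) \<partial>(P \<Otimes>\<^sub>M P))
      \<le> (\<integral>\<^sup>+(s, t). ?G ((h, s), t) \<partial>(P \<Otimes>\<^sub>M P)) + (\<integral>\<^sup>+(s, t). ?H ((h, s), t) \<partial>(P \<Otimes>\<^sub>M P))"
    if h[measurable]: "h \<in> space \<mu>"
      and AE: "AE s in P. A h \<in> edom \<psi> \<and> descent (A h) (C (h, s)) (g (A h) s) (Y (h, s))" for h
  proof -
    \<comment> \<open>The condition does not involve the sample, so under a probability measure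
      holding almost surely means holding.\<close>
    have Ah: "A h \<in> edom \<psi>" using AE by (auto simp: P.AE_prob_1 AE_conj_iff)
    have "(\<lambda>((m, s, y), t). \<gamma> (A h) m s y t) \<in> borel_measurable ((borel \<Otimes>\<^sub>M P \<Otimes>\<^sub>M borel) \<Otimes>\<^sub>M P)"
      using measurable_compose[OF _ \<gamma>, of "\<lambda>z. (A h, fst (fst z), fst (snd (fst z)), snd (snd (fst z)), snd z)"
          "(borel \<Otimes>\<^sub>M P \<Otimes>\<^sub>M borel) \<Otimes>\<^sub>M P"] by (simp add: case_prod_unfold)
    then show ?thesis
      using requirement_at_point[OF Ah, of "\<lambda>s. C (h, s)" "\<lambda>s. Y (h, s)" Mbar "\<gamma> (A h)"] AE Mbar le[OF Ah]
      by (simp add: AE_conj_iff)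
  qed
  moreover have "AE h in \<mu>. AE s in P. A h \<in> edom \<psi> \<and> descent (A h) (C (h, s)) (g (A h) s) (Y (h, s))"
    using \<mu>P.AE_pair[OF descent] by simp
  ultimately have "(\<integral>\<^sup>+h. (\<integral>\<^sup>+(s, t). ?F ((h, s), t) \<partial>(P \<Otimes>\<^sub>M P)) \<partial>\<mu>)
      \<le> (\<integral>\<^sup>+h. (\<integral>\<^sup>+(s, t). ?G ((h, s), t) \<partial>(P \<Otimes>\<^sub>M P)) + (\<integral>\<^sup>+(s, t). ?H ((h, s), t) \<partial>(P \<Otimes>\<^sub>M P)) \<partial>\<mu>)"
    by (intro nn_integral_mono_AE) (use AE_space in \<open>auto elim: eventually_elim2\<close>)
  also have "\<dots> = (\<integral>\<^sup>+h. (\<integral>\<^sup>+(s, t). ?G ((h, s), t) \<partial>(P \<Otimes>\<^sub>M P)) \<partial>\<mu>)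
      + (\<integral>\<^sup>+h. (\<integral>\<^sup>+(s, t). ?H ((h, s), t) \<partial>(P \<Otimes>\<^sub>M P)) \<partial>\<mu>)"
    by (intro nn_integral_add) (simp_all add: case_prod_unfold)
  finally show ?thesis
    by (subst (1 2 3) nn_integral_pair_assoc[OF P.prob_space_axioms]) simp_all
qed

end

section \<open>The algorithm as a random process\<close>

context sgd_setting
begin

text \<open>What remains of \<open>req_lhs\<close> when both linearization errors are dropped and |y
  - x|^2 is replaced by D^2. Paying \<open>next_step\<close> times D^2 / 2 out of the increment
  times D^2 still leaves a positive multiple of the new coefficient.\<close>

definition growth_gap :: "real^'n \<Rightarrow> real \<Rightarrow> 's \<Rightarrow> real^'n \<Rightarrow> 's \<Rightarrow> real" where
  "growth_gap x m s y t = (next_step x m s y t - m) * D\<^sup>2 / 2 + (gbar x - g x s) \<bullet> (y - x) - m * D\<^sup>2 / 2"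

text \<open>The new coefficient, not \<open>m\<close>, multiplies the distance from \<open>y\<close>
  to \<open>xstar\<close>; this makes consecutive steps telescope. The noise is paired with
  \<open>x - xstar\<close>, which is independent of the sample drawn at \<open>x\<close>.\<close>

definition descent_gap :: "real^'n \<Rightarrow> real \<Rightarrow> 's \<Rightarrow> real^'n \<Rightarrow> 's \<Rightarrow> real" where
  "descent_gap x m s y t = (f y + psi_real y) - (f xstar + psi_real xstar)
     - (gbar x - g x s) \<bullet> (x - xstar) - m / 2 * (bnorm B (xstar - x))\<^sup>2
     + next_step x m s y t / 2 * (bnorm B (xstar - y))\<^sup>2"

lemma growth_gap_le:
  assumes "x \<in> edom \<psi>" "s \<in> space P" "t \<in> space P" "descent x m (g x s) y"
  shows "growth_gap x m s y t \<le> req_lhs x m s y t"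
proof -
  have m: "0 \<le> m" and y: "y \<in> edom \<psi>" using assms(4) by (auto simp: descent_def)
  have "m \<le> next_step x m s y t" using m y assms by (intro next_step_ge)
  then have "next_step x m s y t / 2 * (bnorm B (y - x))\<^sup>2 \<le> next_step x m s y t / 2 * D\<^sup>2"
    using m y assms(1) by (intro mult_left_mono bnorm_diff_sq_le) auto
  then show ?thesis
    using lin_error_nonneg[of x y] lin_error_nonneg[of y x]
    by (simp add: growth_gap_def req_lhs_def stepsize_gap_def field_simps)
qed

lemma descent_gap_le:
  assumes "x \<in> edom \<psi>" "s \<in> space P" "t \<in> space P" "descent x m (g x s) y"
  shows "descent_gap x m s y t \<le> req_lhs x m s y t"
proof -
  have m: "0 \<le> m" and y: "y \<in> edom \<psi>" using assms(4) by (auto simp: descent_def)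
  let ?m' = "next_step x m s y t"
  have "m \<le> ?m'" using m y assms by (intro next_step_ge)
  \<comment> \<open>Cost of raising the coefficient in both squared distances at once; the
    right-hand side is the term that \<Omega> = D^2 supplies.\<close>
  then have 1: "(?m' - m) / 2 * ((bnorm B (xstar - y))\<^sup>2 + (bnorm B (y - x))\<^sup>2) \<le> (?m' - m) / 2 * (D\<^sup>2 + D\<^sup>2)"
    using y assms(1) by (intro mult_left_mono add_mono bnorm_diff_sq_le xstar_edom) auto
  have 2: "g x s \<bullet> y + psi_real y + m / 2 * (bnorm B (y - x))\<^sup>2 + m / 2 * (bnorm B (xstar - y))\<^sup>2
       \<le> g x s \<bullet> xstar + psi_real xstar + m / 2 * (bnorm B (xstar - x))\<^sup>2"
    using assms(4) by (simp add: descent_def)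
  have 3: "0 \<le> f xstar - fbar x - gbar x \<bullet> (xstar - x)"
    using lin_error_nonneg[of x xstar] by (simp add: lin_error_def)
  have 4: "lin_error f fbar gbar x y = f y - fbar x - gbar x \<bullet> (y - x)"
    by (simp add: lin_error_def)
  show ?thesis
    using 1 2 3 4 lin_error_nonneg[of y x]
    unfolding descent_gap_def req_lhs_def stepsize_gap_def
    by (simp add: inner_diff_left inner_diff_right field_simps)
qed

lemma measurable_growth_gap:
  "(\<lambda>(x, m, s, y, t). growth_gap x m s y t) \<in> borel_measurable (borel \<Otimes>\<^sub>M borel \<Otimes>\<^sub>M P \<Otimes>\<^sub>M borel \<Otimes>\<^sub>M P)"
  unfolding growth_gap_def case_prod_unfold by measurable

lemma measurable_descent_gap:
  "(\<lambda>(x, m, s, y, t). descent_gap x m s y t) \<in> borel_measurable (borel \<Otimes>\<^sub>M borel \<Otimes>\<^sub>M P \<Otimes>\<^sub>M borel \<Otimes>\<^sub>M P)"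
  unfolding descent_gap_def case_prod_unfold by measurable

end

section \<open>The run as a function of independent samples\<close>

locale sgd_run = sgd_setting B f fbar gbar \<psi> P g upd xstar \<delta> L D \<sigma> c1 c2 c3 c4
  for B :: "real^'n^'n" and f fbar :: "real^'n \<Rightarrow> real" and gbar :: "real^'n \<Rightarrow> real^'n"
    and \<psi> :: "real^'n \<Rightarrow> ereal" and P :: "'s measure" and g :: "real^'n \<Rightarrow> 's \<Rightarrow> real^'n"
    and upd :: "'n stepsize_rule" and xstar :: "real^'n" and \<delta> L D \<sigma> c1 c2 c3 c4 :: real +
  fixes W :: "'w measure" and \<xi> :: "nat \<Rightarrow> 'w \<Rightarrow> 's" and X :: "nat \<Rightarrow> 'w \<Rightarrow> real^'n"
    and m :: "nat \<Rightarrow> 'w \<Rightarrow> real" and x0 :: "real^'n" and N :: nat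
  assumes N_pos: "N \<ge> 1"
    and x0: "x0 \<in> edom \<psi>"
    and run: "universal_sgd B \<psi> P g upd W \<xi> x0 0 N D X m"
begin

sublocale W: prob_space W
  using run by (simp add: universal_sgd_def iid_samples_def)

abbreviation past :: "nat \<Rightarrow> 'w \<Rightarrow> nat \<Rightarrow> 's" where
  "past k \<omega> \<equiv> (\<lambda>i\<in>{..<k}. \<xi> i \<omega>)"

abbreviation past_space :: "nat \<Rightarrow> (nat \<Rightarrow> 's) measure" where
  "past_space k \<equiv> PiM {..<k} (\<lambda>_. P)"

lemma indep_samples: "W.indep_vars (\<lambda>_. P) \<xi> {..N}"
  using run by (simp add: universal_sgd_def iid_samples_def)

lemma measurable_sample [measurable]: "k \<le> N \<Longrightarrow> \<xi> k \<in> measurable W P"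
  using indep_samples by (auto simp: W.indep_vars_def)

lemma distr_sample: "k \<le> N \<Longrightarrow> distr W P (\<xi> k) = P"
  using run by (simp add: universal_sgd_def iid_samples_def)

lemma sample_space: "k \<le> N \<Longrightarrow> \<omega> \<in> space W \<Longrightarrow> \<xi> k \<omega> \<in> space P"
  using measurable_space[OF measurable_sample] by blast

lemma measurable_past [measurable]: "k \<le> Suc N \<Longrightarrow> past k \<in> measurable W (past_space k)"
  by (intro measurable_restrict measurable_sample) auto

lemma past_Suc: "past (Suc k) \<omega> = (past k \<omega>)(k := \<xi> k \<omega>)"
  by (auto simp: fun_eq_iff restrict_def)

lemma X_0: "\<omega> \<in> space W \<Longrightarrow> X 0 \<omega> = x0" and m_0: "\<omega> \<in> space W \<Longrightarrow> m 0 \<omega> = 0"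
  using run by (auto simp: universal_sgd_def)

lemma X_prox: "k < N \<Longrightarrow> \<omega> \<in> space W \<Longrightarrow> X (Suc k) \<omega> \<in> prox B \<psi> (X k \<omega>) (g (X k \<omega>) (\<xi> k \<omega>)) (m k \<omega>)"
  using run by (auto simp: universal_sgd_def)

lemma m_Suc: "k < N \<Longrightarrow> \<omega> \<in> space W
    \<Longrightarrow> m (Suc k) \<omega> = next_step (X k \<omega>) (m k \<omega>) (\<xi> k \<omega>) (X (Suc k) \<omega>) (\<xi> (Suc k) \<omega>)"
  using run by (auto simp: universal_sgd_def next_step_def)

lemma X_edom: "k \<le> N \<Longrightarrow> \<omega> \<in> space W \<Longrightarrow> X k \<omega> \<in> edom \<psi>"
proof (cases k)
  case (Suc j)
  assume "k \<le> N" "\<omega> \<in> space W"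
  then show ?thesis using X_prox[of j \<omega>] by (simp add: Suc prox_def is_arg_min_def)
qed (simp add: X_0 x0)

lemma m_nonneg: "k \<le> N \<Longrightarrow> \<omega> \<in> space W \<Longrightarrow> 0 \<le> m k \<omega>"
proof (induction k)
  case (Suc k)
  then have "m k \<omega> \<le> m (Suc k) \<omega>"
    by (subst m_Suc) (auto intro!: next_step_ge X_edom sample_space)
  then show ?case using Suc by simp
qed (simp add: m_0)

lemma m_mono: "k < N \<Longrightarrow> \<omega> \<in> space W \<Longrightarrow> m k \<omega> \<le> m (Suc k) \<omega>"
  by (subst m_Suc) (auto intro!: next_step_ge X_edom sample_space m_nonneg)

lemma run_descent: "k < N \<Longrightarrow> \<omega> \<in> space W \<Longrightarrow> descent (X k \<omega>) (m k \<omega>) (g (X k \<omega>) (\<xi> k \<omega>)) (X (Suc k) \<omega>)"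
  unfolding descent_def
  using prox_three_point[OF closed_psi pos_def X_prox xstar_edom]
  by (auto intro: X_edom m_nonneg)

lemma X_factor:
  assumes "k \<le> N"
  obtains A where "A \<in> borel_measurable (past_space k)" "\<And>\<omega>. \<omega> \<in> space W \<Longrightarrow> X k \<omega> = A (past k \<omega>)"
proof (rule factor_through_vimage_algebra)
  show "past k \<in> space W \<rightarrow> space (past_space k)"
    using measurable_space[OF measurable_past, of k] assms by auto
  show "X k \<in> borel_measurable (vimage_algebra (space W) (past k) (past_space k))"
    using run assms by (simp add: universal_sgd_def history_def)
qed (rule that)

lemma X_Suc_factor:
  assumes "k < N"
  obtains Y where "Y \<in> borel_measurable (past_space k \<Otimes>\<^sub>M P)"
    "\<And>\<omega>. \<omega> \<in> space W \<Longrightarrow> X (Suc k) \<omega> = Y (past k \<omega>, \<xi> k \<omega>)"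
proof -
  obtain A where A: "A \<in> borel_measurable (past_space (Suc k))" "\<And>\<omega>. \<omega> \<in> space W \<Longrightarrow> X (Suc k) \<omega> = A (past (Suc k) \<omega>)"
    using X_factor[of "Suc k"] assms by auto
  have "(\<lambda>(h, s). h(k := s)) \<in> measurable (past_space k \<Otimes>\<^sub>M P) (past_space (Suc k))"
    unfolding lessThan_Suc by (rule measurable_add_dim)
  from measurable_compose[OF this A(1)] show ?thesis
    using A(2) by (intro that[of "\<lambda>z. A (case z of (h, s) \<Rightarrow> h(k := s))"]) (auto simp: past_Suc)
qed

text \<open>For \<open>k > 0\<close> the coefficient \<open>m k\<close> was computed from the
  gradient at \<open>X k\<close>, so it depends on \<open>\<xi> k\<close> as well as on the past.
  Its measurability is inherited from the iterates and the update rule through the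
  recursion.\<close>

lemma m_factor:
  assumes "k < N"
  obtains C where "C \<in> borel_measurable (past_space k \<Otimes>\<^sub>M P)"
    "\<And>\<omega>. \<omega> \<in> space W \<Longrightarrow> m k \<omega> = C (past k \<omega>, \<xi> k \<omega>)"
proof -
  have "\<exists>C. C \<in> borel_measurable (past_space k \<Otimes>\<^sub>M P) \<and> (\<forall>\<omega>\<in>space W. m k \<omega> = C (past k \<omega>, \<xi> k \<omega>))"
    using assms
  proof (induction k)
    case 0
    then show ?case by (intro exI[of _ "\<lambda>_. 0"]) (simp add: m_0)
  next
    case (Suc k)
    then obtain C where C[measurable]: "C \<in> borel_measurable (past_space k \<Otimes>\<^sub>M P)"
      and Ceq: "\<And>\<omega>. \<omega> \<in> space W \<Longrightarrow> m k \<omega> = C (past k \<omega>, \<xi> k \<omega>)" by (meson Suc_lessD)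
    obtain A where A[measurable]: "A \<in> borel_measurable (past_space k)"
      and Aeq: "\<And>\<omega>. \<omega> \<in> space W \<Longrightarrow> X k \<omega> = A (past k \<omega>)"
      using X_factor[of k] Suc.prems by auto
    obtain Y where Y[measurable]: "Y \<in> borel_measurable (past_space (Suc k))"
      and Yeq: "\<And>\<omega>. \<omega> \<in> space W \<Longrightarrow> X (Suc k) \<omega> = Y (past (Suc k) \<omega>)"
      using X_factor[of "Suc k"] Suc.prems by auto
    \<comment> \<open>The past of length \<open>Suc k\<close> contains both arguments of the
      previous factor: its restriction is the shorter past, and its component \<open>k\<close> is
      the sample \<open>\<xi> k\<close>.\<close>
    let ?r = "\<lambda>z. restrict (fst z) {..<k}"
    have [measurable]: "?r \<in> measurable (past_space (Suc k) \<Otimes>\<^sub>M P) (past_space k)"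
      by (rule measurable_compose[OF measurable_fst measurable_restrict_subset]) auto
    have [measurable]: "(\<lambda>z. fst z k) \<in> measurable (past_space (Suc k) \<Otimes>\<^sub>M P) P"
      by (rule measurable_compose[OF measurable_fst measurable_component_singleton]) auto
    have restr: "restrict (past (Suc k) \<omega>) {..<k} = past k \<omega>" for \<omega>
      by (auto simp: fun_eq_iff restrict_def)
    show ?case
    proof (intro exI conjI ballI)
      show "(\<lambda>z. next_step (A (?r z)) (C (?r z, fst z k)) (fst z k) (Y (fst z)) (snd z))
        \<in> borel_measurable (past_space (Suc k) \<Otimes>\<^sub>M P)" by measurable
      fix \<omega> assume "\<omega> \<in> space W"
      then show "m (Suc k) \<omega> = (\<lambda>z. next_step (A (?r z)) (C (?r z, fst z k)) (fst z k) (Y (fst z)) (snd z))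
          (past (Suc k) \<omega>, \<xi> (Suc k) \<omega>)"
        using Suc.prems unfolding fst_conv snd_conv restr
        by (simp add: m_Suc Aeq[symmetric] Ceq[symmetric] Yeq[symmetric])
    qed
  qed
  then show ?thesis using that by blast
qed

text \<open>The intermediate \<open>PiM {k}\<close> is needed because \<open>indep_var\<close> relates variables of the same type.\<close>

lemma distr_past_sample:
  assumes "k \<le> N"
  shows "distr W (past_space k \<Otimes>\<^sub>M P) (\<lambda>\<omega>. (past k \<omega>, \<xi> k \<omega>)) = distr W (past_space k) (past k) \<Otimes>\<^sub>M P"
proof -
  let ?K = "PiM {k} (\<lambda>_. P)" and ?r = "\<lambda>\<omega>. \<lambda>i\<in>{k}. \<xi> i \<omega>"
  let ?\<mu> = "distr W (past_space k) (past k)" and ?\<nu> = "distr W ?K ?r"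
  have past: "past k \<in> measurable W (past_space k)" using assms by (intro measurable_past) auto
  have r: "?r \<in> measurable W ?K" using assms by (intro measurable_restrict measurable_sample) auto
  have proj: "(\<lambda>v. v k) \<in> measurable ?K P" by (rule measurable_component_singleton) simp
  have \<nu>: "distr ?\<nu> P (\<lambda>v. v k) = P"
    using distr_sample[OF assms] by (subst distr_distr[OF proj r]) (simp add: comp_def)
  have map: "(\<lambda>(u, v). (u, v k)) \<in> measurable (past_space k \<Otimes>\<^sub>M ?K) (past_space k \<Otimes>\<^sub>M P)"
    using measurable_compose[OF measurable_snd proj] by (simp add: case_prod_unfold)
  have "W.indep_var (past_space k) (past k) ?K ?r"
    using assms by (intro W.indep_var_restrict[OF indep_samples]) auto
  then have "?\<mu> \<Otimes>\<^sub>M ?\<nu> = distr W (past_space k \<Otimes>\<^sub>M ?K) (\<lambda>\<omega>. (past k \<omega>, ?r \<omega>))"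
    by (simp only: W.indep_var_distribution_eq)
  then have "distr (?\<mu> \<Otimes>\<^sub>M ?\<nu>) (past_space k \<Otimes>\<^sub>M P) (\<lambda>(u, v). (u, v k))
      = distr W (past_space k \<Otimes>\<^sub>M P) (\<lambda>\<omega>. (past k \<omega>, \<xi> k \<omega>))"
    using distr_distr[OF map measurable_Pair[OF past r]] by (simp add: comp_def)
  moreover have "distr (?\<mu> \<Otimes>\<^sub>M ?\<nu>) (past_space k \<Otimes>\<^sub>M P) (\<lambda>(u, v). (u, v k)) = ?\<mu> \<Otimes>\<^sub>M P"
    using pair_measure_distr[of "\<lambda>u. u" ?\<mu> "past_space k" "\<lambda>v. v k" ?\<nu> P] proj \<nu>
      prob_space_imp_sigma_finite[OF P.prob_space_axioms]
    by (simp add: distr_id2)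
  ultimately show ?thesis by simp
qed

text \<open>Independence of the last sample from the longer past, followed by a split of that past
  into its first \<open>k\<close> samples and sample \<open>k\<close>, where independence is used
  again.\<close>

lemma distr_past_sample_sample:
  assumes "k < N"
  shows "distr W ((past_space k \<Otimes>\<^sub>M P) \<Otimes>\<^sub>M P) (\<lambda>\<omega>. ((past k \<omega>, \<xi> k \<omega>), \<xi> (Suc k) \<omega>))
    = (distr W (past_space k) (past k) \<Otimes>\<^sub>M P) \<Otimes>\<^sub>M P"
proof -
  let ?r = "\<lambda>u. (restrict u {..<k}, u k)"
  let ?H = "past_space (Suc k)" and ?T = "past_space k \<Otimes>\<^sub>M P"
  have r: "?r \<in> measurable ?H ?T"
    by (intro measurable_Pair measurable_restrict_subset measurable_component_singleton) auto
  have past: "past (Suc k) \<in> measurable W ?H" using assms by (intro measurable_past) auto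
  have \<xi>: "\<xi> (Suc k) \<in> measurable W P" using assms by (intro measurable_sample) auto
  have map: "(\<lambda>(u, t). (?r u, t)) \<in> measurable (?H \<Otimes>\<^sub>M P) (?T \<Otimes>\<^sub>M P)"
    using measurable_compose[OF measurable_fst r] by (simp add: case_prod_unfold)
  have restr: "?r (past (Suc k) \<omega>) = (past k \<omega>, \<xi> k \<omega>)" for \<omega>
    by (auto simp: fun_eq_iff restrict_def)
  have "distr (distr W ?H (past (Suc k)) \<Otimes>\<^sub>M P) (?T \<Otimes>\<^sub>M P) (\<lambda>(u, t). (?r u, t))
      = distr W (?T \<Otimes>\<^sub>M P) (\<lambda>\<omega>. ((past k \<omega>, \<xi> k \<omega>), \<xi> (Suc k) \<omega>))"
    using distr_distr[OF map measurable_Pair[OF past \<xi>]] distr_past_sample[of "Suc k"] assms restr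
    by (simp add: comp_def)
  moreover have "distr (distr W ?H (past (Suc k)) \<Otimes>\<^sub>M P) (?T \<Otimes>\<^sub>M P) (\<lambda>(u, t). (?r u, t))
      = distr (distr W ?H (past (Suc k))) ?T ?r \<Otimes>\<^sub>M P"
    using pair_measure_distr[of ?r "distr W ?H (past (Suc k))" ?T "\<lambda>t. t" P P] r
      prob_space_imp_sigma_finite[OF P.prob_space_axioms]
    by (simp add: distr_id2)
  moreover have "distr (distr W ?H (past (Suc k))) ?T ?r = distr W (past_space k) (past k) \<Otimes>\<^sub>M P"
    using distr_distr[OF r past] distr_past_sample[of k] assms restr by (simp add: comp_def)
  ultimately show ?thesis by simp
qed

lemma measurable_X [measurable]: "k \<le> N \<Longrightarrow> X k \<in> borel_measurable W"
proof -
  assume k: "k \<le> N"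
  obtain A where A: "A \<in> borel_measurable (past_space k)" "\<And>\<omega>. \<omega> \<in> space W \<Longrightarrow> X k \<omega> = A (past k \<omega>)"
    using X_factor[OF k] by auto
  then show ?thesis
    using measurable_compose[OF measurable_past A(1)] k by (simp cong: measurable_cong)
qed

lemma measurable_m [measurable]: "k \<le> N \<Longrightarrow> m k \<in> borel_measurable W"
proof (induction k)
  case 0
  then show ?case using m_0 by (simp cong: measurable_cong)
next
  case (Suc k)
  then have [measurable]: "m k \<in> borel_measurable W" "X k \<in> borel_measurable W" "X (Suc k) \<in> borel_measurable W"
    "\<xi> k \<in> measurable W P" "\<xi> (Suc k) \<in> measurable W P"
    using measurable_X measurable_sample by auto
  have "(\<lambda>\<omega>. next_step (X k \<omega>) (m k \<omega>) (\<xi> k \<omega>) (X (Suc k) \<omega>) (\<xi> (Suc k) \<omega>)) \<in> borel_measurable W"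
    by measurable
  then show ?case using m_Suc[of k] Suc.prems by (simp cong: measurable_cong)
qed

text \<open>Conditionally on the samples before step \<open>k\<close>, the iterate \<open>X k\<close> is a constant, so the
  requirement on the stepsize rule applies with the law of \<open>(m k, \<xi> k, X (Suc k))\<close>.\<close>

lemma requirement_run:
  fixes \<gamma> :: "real^'n \<Rightarrow> real \<Rightarrow> 's \<Rightarrow> real^'n \<Rightarrow> 's \<Rightarrow> real"
  assumes k: "k < N" and Mbar: "Mbar > c2 * L"
    and \<gamma>: "(\<lambda>(x, m, s, y, t). \<gamma> x m s y t) \<in> borel_measurable (borel \<Otimes>\<^sub>M borel \<Otimes>\<^sub>M P \<Otimes>\<^sub>M borel \<Otimes>\<^sub>M P)"
    and le: "\<And>x m s y t. \<lbrakk>x \<in> edom \<psi>; s \<in> space P; t \<in> space P; descent x m (g x s) y\<rbrakk>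
      \<Longrightarrow> \<gamma> x m s y t \<le> req_lhs x m s y t"
  shows "(\<integral>\<^sup>+\<omega>. ennreal (\<gamma> (X k \<omega>) (m k \<omega>) (\<xi> k \<omega>) (X (Suc k) \<omega>) (\<xi> (Suc k) \<omega>)) \<partial>W)
    \<le> (\<integral>\<^sup>+\<omega>. ennreal (req_rhs Mbar (X k \<omega>) (m k \<omega>) (\<xi> k \<omega>) (X (Suc k) \<omega>) (\<xi> (Suc k) \<omega>)) \<partial>W)
      + (\<integral>\<^sup>+\<omega>. ennreal (- \<gamma> (X k \<omega>) (m k \<omega>) (\<xi> k \<omega>) (X (Suc k) \<omega>) (\<xi> (Suc k) \<omega>)) \<partial>W)"
proof -
  obtain A where A[measurable]: "A \<in> borel_measurable (past_space k)"
    and Aeq: "\<And>\<omega>. \<omega> \<in> space W \<Longrightarrow> X k \<omega> = A (past k \<omega>)" using X_factor[of k] k by auto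
  obtain Y where Y[measurable]: "Y \<in> borel_measurable (past_space k \<Otimes>\<^sub>M P)"
    and Yeq: "\<And>\<omega>. \<omega> \<in> space W \<Longrightarrow> X (Suc k) \<omega> = Y (past k \<omega>, \<xi> k \<omega>)" using X_Suc_factor[OF k] by auto
  obtain C where C[measurable]: "C \<in> borel_measurable (past_space k \<Otimes>\<^sub>M P)"
    and Ceq: "\<And>\<omega>. \<omega> \<in> space W \<Longrightarrow> m k \<omega> = C (past k \<omega>, \<xi> k \<omega>)" using m_factor[OF k] by auto
  define \<mu> where "\<mu> = distr W (past_space k) (past k)"
  have past: "past k \<in> measurable W (past_space k)" using k by (intro measurable_past) auto
  have [measurable]: "\<xi> k \<in> measurable W P" "\<xi> (Suc k) \<in> measurable W P" using k by (auto intro: measurable_sample)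
  have sets[measurable_cong]: "sets \<mu> = sets (past_space k)" by (simp add: \<mu>_def)
  have \<mu>: "prob_space \<mu>" unfolding \<mu>_def by (rule W.prob_space_distr[OF past])
  have transfer: "(\<integral>\<^sup>+z. F z \<partial>((\<mu> \<Otimes>\<^sub>M P) \<Otimes>\<^sub>M P)) = (\<integral>\<^sup>+\<omega>. F ((past k \<omega>, \<xi> k \<omega>), \<xi> (Suc k) \<omega>) \<partial>W)"
    if "F \<in> borel_measurable ((past_space k \<Otimes>\<^sub>M P) \<Otimes>\<^sub>M P)" for F :: "_ \<Rightarrow> ennreal"
    unfolding \<mu>_def distr_past_sample_sample[OF k, symmetric]
    by (rule nn_integral_distr) (use past that in \<open>auto intro: measurable_Pair\<close>)
  \<comment> \<open>The factors \<open>A\<close>, \<open>C\<close> and \<open>Y\<close> agree with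
    the run only on the values actually taken by the samples, so the property is available almost
    surely rather than everywhere.\<close>
  have desc: "AE z in \<mu> \<Otimes>\<^sub>M P. A (fst z) \<in> edom \<psi> \<and> descent (A (fst z)) (C z) (g (A (fst z)) (snd z)) (Y z)"
    unfolding \<mu>_def distr_past_sample[OF less_imp_le[OF k], symmetric]
  proof (subst AE_distr_iff)
    show "(\<lambda>\<omega>. (past k \<omega>, \<xi> k \<omega>)) \<in> measurable W (past_space k \<Otimes>\<^sub>M P)" using past by measurable
    show "{z \<in> space (past_space k \<Otimes>\<^sub>M P). A (fst z) \<in> edom \<psi> \<and> descent (A (fst z)) (C z) (g (A (fst z)) (snd z)) (Y z)}
        \<in> sets (past_space k \<Otimes>\<^sub>M P)" by measurable
    show "AE \<omega> in W. A (fst (past k \<omega>, \<xi> k \<omega>)) \<in> edom \<psi> \<and> descent (A (fst (past k \<omega>, \<xi> k \<omega>)))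
        (C (past k \<omega>, \<xi> k \<omega>)) (g (A (fst (past k \<omega>, \<xi> k \<omega>))) (snd (past k \<omega>, \<xi> k \<omega>))) (Y (past k \<omega>, \<xi> k \<omega>))"
    proof (rule AE_I2)
      fix \<omega> assume \<omega>: "\<omega> \<in> space W"
      then show "A (fst (past k \<omega>, \<xi> k \<omega>)) \<in> edom \<psi> \<and> descent (A (fst (past k \<omega>, \<xi> k \<omega>)))
        (C (past k \<omega>, \<xi> k \<omega>)) (g (A (fst (past k \<omega>, \<xi> k \<omega>))) (snd (past k \<omega>, \<xi> k \<omega>))) (Y (past k \<omega>, \<xi> k \<omega>))"
        using X_edom[of k \<omega>] run_descent[OF k \<omega>] k unfolding fst_conv snd_conv
        by (simp only: Aeq Yeq Ceq less_imp_le)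
    qed
  qed
  have meas: "(\<lambda>z. \<gamma> (A (fst (fst z))) (C (fst z)) (snd (fst z)) (Y (fst z)) (snd z))
      \<in> borel_measurable ((past_space k \<Otimes>\<^sub>M P) \<Otimes>\<^sub>M P)"
    using measurable_compose[OF _ \<gamma>, of "\<lambda>z. (A (fst (fst z)), C (fst z), snd (fst z), Y (fst z), snd z)"
        "(past_space k \<Otimes>\<^sub>M P) \<Otimes>\<^sub>M P"] by simp
  note avg = requirement_average[OF \<mu> _ _ _ desc Mbar \<gamma> le]
  have eq: "(\<integral>\<^sup>+\<omega>. ennreal (F (X k \<omega>) (m k \<omega>) (\<xi> k \<omega>) (X (Suc k) \<omega>) (\<xi> (Suc k) \<omega>)) \<partial>W)
      = (\<integral>\<^sup>+z. ennreal (F (A (fst (fst z))) (C (fst z)) (snd (fst z)) (Y (fst z)) (snd z)) \<partial>((\<mu> \<Otimes>\<^sub>M P) \<Otimes>\<^sub>M P))"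
    if "(\<lambda>z. F (A (fst (fst z))) (C (fst z)) (snd (fst z)) (Y (fst z)) (snd z))
      \<in> borel_measurable ((past_space k \<Otimes>\<^sub>M P) \<Otimes>\<^sub>M P)" for F :: "real^'n \<Rightarrow> real \<Rightarrow> 's \<Rightarrow> real^'n \<Rightarrow> 's \<Rightarrow> real"
    using that by (subst transfer) (auto intro!: nn_integral_cong simp: Aeq Yeq Ceq)
  show ?thesis
    unfolding eq[OF meas] eq[OF borel_measurable_uminus[OF meas]]
    by (subst eq, measurable, rule avg) (simp_all add: measurable_cong_sets[OF sets refl])
qed

end

section \<open>Integrability and the telescoping sum\<close>

context sgd_run
begin

abbreviation at_step :: "(real^'n \<Rightarrow> real \<Rightarrow> 's \<Rightarrow> real^'n \<Rightarrow> 's \<Rightarrow> real) \<Rightarrow> nat \<Rightarrow> 'w \<Rightarrow> real" where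
  "at_step F k \<omega> \<equiv> F (X k \<omega>) (m k \<omega>) (\<xi> k \<omega>) (X (Suc k) \<omega>) (\<xi> (Suc k) \<omega>)"

abbreviation noise :: "nat \<Rightarrow> 'w \<Rightarrow> real^'n" where
  "noise k \<omega> \<equiv> gbar (X k \<omega>) - g (X k \<omega>) (\<xi> k \<omega>)"

lemma measurable_at_step:
  assumes "k < N"
    and "(\<lambda>(x, m, s, y, t). F x m s y t) \<in> borel_measurable (borel \<Otimes>\<^sub>M borel \<Otimes>\<^sub>M P \<Otimes>\<^sub>M borel \<Otimes>\<^sub>M P)"
  shows "at_step F k \<in> borel_measurable W"
proof -
  have "(\<lambda>\<omega>. (X k \<omega>, m k \<omega>, \<xi> k \<omega>, X (Suc k) \<omega>, \<xi> (Suc k) \<omega>))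
      \<in> measurable W (borel \<Otimes>\<^sub>M borel \<Otimes>\<^sub>M P \<Otimes>\<^sub>M borel \<Otimes>\<^sub>M P)"
    using assms(1) by (intro measurable_Pair measurable_X measurable_m measurable_sample) auto
  from measurable_compose[OF this assms(2)] show ?thesis by simp
qed

text \<open>Truncation at \<open>Mbar\<close> bounds each increment by \<open>Mbar\<close>, since
  \<open>m k\<close> is nonnegative. The right-hand side is thus finite before anything is known
  about the moments of the coefficients.\<close>

lemma req_rhs_integrable:
  assumes k: "k < N" and Mbar: "Mbar > c2 * L"
  shows "integrable W (at_step (req_rhs Mbar) k)"
proof (rule W.integrable_const_bound)
  have [simp]: "0 \<le> Mbar" using Mbar mult_nonneg_nonneg[OF less_imp_le[OF c_pos(2)] L_nonneg] by linarith
  show "AE \<omega> in W. norm (at_step (req_rhs Mbar) k \<omega>)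
      \<le> c1 / (Mbar - c2 * L) * (2 * \<sigma>\<^sup>2) + c3 * \<delta> + c4 * (Mbar * D\<^sup>2)"
  proof (rule AE_I2)
    fix \<omega> assume "\<omega> \<in> space W"
    then have "max 0 (min (at_step next_step k \<omega>) Mbar - m k \<omega>) \<le> Mbar"
      using m_nonneg[of k \<omega>] k by (auto simp: min_def max_def)
    then have "c4 * (max 0 (min (at_step next_step k \<omega>) Mbar - m k \<omega>) * D\<^sup>2) \<le> c4 * (Mbar * D\<^sup>2)"
      using c_pos by (intro mult_left_mono mult_right_mono) auto
    then show "norm (at_step (req_rhs Mbar) k \<omega>)
      \<le> c1 / (Mbar - c2 * L) * (2 * \<sigma>\<^sup>2) + c3 * \<delta> + c4 * (Mbar * D\<^sup>2)"
      using req_rhs_nonneg[OF Mbar, of "X k \<omega>" "m k \<omega>" "\<xi> k \<omega>" "X (Suc k) \<omega>" "\<xi> (Suc k) \<omega>"]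
      by (simp add: req_rhs_def)
  qed
  have "(\<lambda>(x, m, s, y, t). req_rhs Mbar x m s y t)
      \<in> borel_measurable (borel \<Otimes>\<^sub>M borel \<Otimes>\<^sub>M P \<Otimes>\<^sub>M borel \<Otimes>\<^sub>M P)"
    unfolding case_prod_unfold by measurable
  then show "at_step (req_rhs Mbar) k \<in> borel_measurable W" by (rule measurable_at_step[OF k])
qed

text \<open>The dominating function \<open>V\<close> makes the negative part of
  \<open>\<gamma>\<close> finite, and the requirement then forces the positive part to be finite.
  Only after this may the negative part be moved back and the inequality be read between
  expectations.\<close>

lemma requirement_expectation:
  fixes \<gamma> :: "real^'n \<Rightarrow> real \<Rightarrow> 's \<Rightarrow> real^'n \<Rightarrow> 's \<Rightarrow> real"
  assumes k: "k < N" and Mbar: "Mbar > c2 * L"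
    and \<gamma>: "(\<lambda>(x, m, s, y, t). \<gamma> x m s y t) \<in> borel_measurable (borel \<Otimes>\<^sub>M borel \<Otimes>\<^sub>M P \<Otimes>\<^sub>M borel \<Otimes>\<^sub>M P)"
    and le: "\<And>x m s y t. \<lbrakk>x \<in> edom \<psi>; s \<in> space P; t \<in> space P; descent x m (g x s) y\<rbrakk>
      \<Longrightarrow> \<gamma> x m s y t \<le> req_lhs x m s y t"
    and V: "integrable W V" and lower: "\<And>\<omega>. \<omega> \<in> space W \<Longrightarrow> - at_step \<gamma> k \<omega> \<le> V \<omega>"
  shows "integrable W (at_step \<gamma> k)"
    and "(LINT \<omega>|W. at_step \<gamma> k \<omega>) \<le> (LINT \<omega>|W. at_step (req_rhs Mbar) k \<omega>)"
proof -
  let ?p = "\<integral>\<^sup>+\<omega>. ennreal (at_step \<gamma> k \<omega>) \<partial>W" and ?n = "\<integral>\<^sup>+\<omega>. ennreal (- at_step \<gamma> k \<omega>) \<partial>W"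
  have meas: "at_step \<gamma> k \<in> borel_measurable W" by (rule measurable_at_step[OF k \<gamma>])
  have "(\<integral>\<^sup>+\<omega>. ennreal (at_step (req_rhs Mbar) k \<omega>) \<partial>W) = ennreal (LINT \<omega>|W. at_step (req_rhs Mbar) k \<omega>)"
    using req_rhs_integrable[OF k Mbar] by (intro nn_integral_eq_integral) (auto intro: req_rhs_nonneg[OF Mbar])
  then have le: "?p \<le> ennreal (LINT \<omega>|W. at_step (req_rhs Mbar) k \<omega>) + ?n"
    using requirement_run[OF k Mbar \<gamma> le] by simp
  have "?n \<le> (\<integral>\<^sup>+\<omega>. ennreal (norm (V \<omega>)) \<partial>W)"
  proof (intro nn_integral_mono ennreal_leI)
    fix \<omega> assume "\<omega> \<in> space W"
    from lower[OF this] show "- at_step \<gamma> k \<omega> \<le> norm (V \<omega>)" by simp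
  qed
  also have "\<dots> < \<infinity>" using V by (simp add: integrable_iff_bounded)
  finally have n: "?n \<noteq> \<infinity>" by simp
  then have "?p \<noteq> \<infinity>" using le by (auto simp: top_unique)
  with n meas show int: "integrable W (at_step \<gamma> k)" by (simp add: real_integrable_def)
  show "(LINT \<omega>|W. at_step \<gamma> k \<omega>) \<le> (LINT \<omega>|W. at_step (req_rhs Mbar) k \<omega>)"
  proof -
    have 0: "0 \<le> (LINT \<omega>|W. at_step (req_rhs Mbar) k \<omega>)"
      by (intro integral_nonneg_AE) (simp add: req_rhs_nonneg[OF Mbar])
    have "?p \<noteq> top" "?n \<noteq> top" using n \<open>?p \<noteq> \<infinity>\<close> by auto
    then obtain a b where "?p = ennreal a" "0 \<le> a" "?n = ennreal b" "0 \<le> b"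
      by (cases "?p"; cases "?n") blast+
    then show ?thesis
      using le 0 unfolding real_lebesgue_integral_def[OF int]
      by (simp add: ennreal_plus[symmetric] del: ennreal_plus)
  qed
qed

section \<open>Gradient noise: integrability and zero mean\<close>

lemma AE_past_iterate_in_edom:
  assumes "k \<le> N" and [measurable]: "A \<in> borel_measurable (past_space k)"
    and "\<And>\<omega>. \<omega> \<in> space W \<Longrightarrow> X k \<omega> = A (past k \<omega>)"
  shows "AE h in distr W (past_space k) (past k). A h \<in> edom \<psi>"
proof (subst AE_distr_iff)
  show "past k \<in> measurable W (past_space k)" using assms by (intro measurable_past) auto
  show "{h \<in> space (past_space k). A h \<in> edom \<psi>} \<in> sets (past_space k)" by measurable
  show "AE \<omega> in W. A (past k \<omega>) \<in> edom \<psi>"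
    using X_edom[OF assms(1)] assms(3) by (intro AE_I2) simp
qed

text \<open>With the past fixed, the second moment of the noise is the oracle variance at a point of
  the domain, hence at most \<open>\<sigma>\<^sup>2\<close>. Square integrability implies
  integrability on a probability space.\<close>

lemma noise_dual_norm_integrable:
  assumes k: "k < N"
  shows "integrable W (\<lambda>\<omega>. dual_norm B (g (X k \<omega>) (\<xi> k \<omega>) - gbar (X k \<omega>)))"
proof -
  obtain A where A[measurable]: "A \<in> borel_measurable (past_space k)"
    and Aeq: "\<And>\<omega>. \<omega> \<in> space W \<Longrightarrow> X k \<omega> = A (past k \<omega>)" using X_factor[of k] k by auto
  define \<mu> where "\<mu> = distr W (past_space k) (past k)"
  have past: "past k \<in> measurable W (past_space k)" using k by (intro measurable_past) auto
  have [measurable]: "\<xi> k \<in> measurable W P" "X k \<in> borel_measurable W"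
    using k by (auto intro: measurable_sample measurable_X)
  have sets[measurable_cong]: "sets \<mu> = sets (past_space k)" by (simp add: \<mu>_def)
  interpret \<mu>: prob_space \<mu> unfolding \<mu>_def by (rule W.prob_space_distr[OF past])
  have ae: "AE h in \<mu>. A h \<in> edom \<psi>"
    unfolding \<mu>_def by (rule AE_past_iterate_in_edom[OF less_imp_le[OF k] A]) (rule Aeq)
  let ?F = "\<lambda>z. ennreal ((dual_norm B (g (A (fst z)) (snd z) - gbar (A (fst z))))\<^sup>2)"
  have "(\<integral>\<^sup>+\<omega>. ennreal ((dual_norm B (g (X k \<omega>) (\<xi> k \<omega>) - gbar (X k \<omega>)))\<^sup>2) \<partial>W)
      = (\<integral>\<^sup>+\<omega>. ?F (past k \<omega>, \<xi> k \<omega>) \<partial>W)"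
    by (intro nn_integral_cong) (simp add: Aeq)
  also have "\<dots> = (\<integral>\<^sup>+z. ?F z \<partial>(\<mu> \<Otimes>\<^sub>M P))"
    unfolding \<mu>_def distr_past_sample[OF less_imp_le[OF k], symmetric]
    by (rule nn_integral_distr[symmetric]) (use past in \<open>auto intro: measurable_Pair\<close>)
  also have "\<dots> = (\<integral>\<^sup>+h. (\<integral>\<^sup>+s. ?F (h, s) \<partial>P) \<partial>\<mu>)"
    by (intro P.nn_integral_fst[symmetric]) measurable
  also have "\<dots> \<le> (\<integral>\<^sup>+h. ennreal (\<sigma>\<^sup>2) \<partial>\<mu>)"
  proof (rule nn_integral_mono_AE)
    show "AE h in \<mu>. (\<integral>\<^sup>+s. ?F (h, s) \<partial>P) \<le> ennreal (\<sigma>\<^sup>2)"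
      using ae
    proof eventually_elim
      case (elim h)
      have "enn2ereal (\<integral>\<^sup>+s. ?F (h, s) \<partial>P) = oracle_var B P g gbar (A h)"
        unfolding oracle_var_def by (subst ext_expectation_nonneg) auto
      also have "\<dots> \<le> enn2ereal (ennreal (\<sigma>\<^sup>2))" using oracle_var_le[OF elim] by (simp add: enn2ereal_ennreal)
      finally show ?case by (simp add: less_eq_ennreal.rep_eq)
    qed
  qed
  also have "\<dots> < \<infinity>" by (simp add: \<mu>.emeasure_space_1)
  finally have "integrable W (\<lambda>\<omega>. (dual_norm B (g (X k \<omega>) (\<xi> k \<omega>) - gbar (X k \<omega>)))\<^sup>2)"
    by (intro integrableI_bounded) (auto simp: power_abs[symmetric])
  moreover have "(\<lambda>\<omega>. dual_norm B (g (X k \<omega>) (\<xi> k \<omega>) - gbar (X k \<omega>))) \<in> borel_measurable W"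
    by measurable
  ultimately show ?thesis by (rule W.square_integrable_imp_integrable[rotated])
qed

lemma noise_inner_le:
  assumes "x \<in> edom \<psi>" "y \<in> edom \<psi>"
  shows "\<bar>(gbar z - u) \<bullet> (x - y)\<bar> \<le> dual_norm B (u - gbar z) * D"
proof -
  have "\<bar>(gbar z - u) \<bullet> (x - y)\<bar> = \<bar>(u - gbar z) \<bullet> (x - y)\<bar>"
    by (simp add: inner_diff_left abs_minus_commute)
  also have "\<dots> \<le> dual_norm B (u - gbar z) * bnorm B (x - y)"
    by (rule abs_inner_le_dual_norm[OF pos_def])
  also have "\<dots> \<le> dual_norm B (u - gbar z) * D"
    using assms by (intro mult_left_mono bnorm_diff_le dual_norm_nonneg pos_def)
  finally show ?thesis .
qed

text \<open>Duality of the norms together with the diameter bound dominates the product by the noise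
  norm. No independence enters, so \<open>Y\<close> may be \<open>X (Suc k)\<close>, which depends
  on the same sample.\<close>

lemma noise_inner_integrable:
  assumes k: "k < N" and [measurable]: "Y \<in> borel_measurable W" "Z \<in> borel_measurable W"
    and "\<And>\<omega>. \<omega> \<in> space W \<Longrightarrow> Y \<omega> \<in> edom \<psi>" "\<And>\<omega>. \<omega> \<in> space W \<Longrightarrow> Z \<omega> \<in> edom \<psi>"
  shows "integrable W (\<lambda>\<omega>. noise k \<omega> \<bullet> (Y \<omega> - Z \<omega>))"
proof (rule Bochner_Integration.integrable_bound)
  show "integrable W (\<lambda>\<omega>. dual_norm B (g (X k \<omega>) (\<xi> k \<omega>) - gbar (X k \<omega>)) * D)"
    using noise_dual_norm_integrable[OF k] by simp
  have [measurable]: "\<xi> k \<in> measurable W P" "X k \<in> borel_measurable W"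
    using k by (auto intro: measurable_sample measurable_X)
  show "(\<lambda>\<omega>. noise k \<omega> \<bullet> (Y \<omega> - Z \<omega>)) \<in> borel_measurable W" by measurable
  show "AE \<omega> in W. norm (noise k \<omega> \<bullet> (Y \<omega> - Z \<omega>))
      \<le> norm (dual_norm B (g (X k \<omega>) (\<xi> k \<omega>) - gbar (X k \<omega>)) * D)"
  proof (rule AE_I2)
    fix \<omega> assume "\<omega> \<in> space W"
    from noise_inner_le[OF assms(4)[OF this] assms(5)[OF this], of "X k \<omega>" "g (X k \<omega>) (\<xi> k \<omega>)"]
    show "norm (noise k \<omega> \<bullet> (Y \<omega> - Z \<omega>)) \<le> norm (dual_norm B (g (X k \<omega>) (\<xi> k \<omega>) - gbar (X k \<omega>)) * D)"
      by simp
  qed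
qed

text \<open>Integrating first over \<open>\<xi> k\<close> with the past frozen leaves
  \<open>A h - xstar\<close> constant, and unbiasedness annihilates the inner integral.\<close>

lemma noise_expectation:
  assumes k: "k < N"
  shows "(LINT \<omega>|W. noise k \<omega> \<bullet> (X k \<omega> - xstar)) = 0"
proof -
  obtain A where A[measurable]: "A \<in> borel_measurable (past_space k)"
    and Aeq: "\<And>\<omega>. \<omega> \<in> space W \<Longrightarrow> X k \<omega> = A (past k \<omega>)" using X_factor[of k] k by auto
  define \<mu> where "\<mu> = distr W (past_space k) (past k)"
  have past: "past k \<in> measurable W (past_space k)" using k by (intro measurable_past) auto
  have [measurable]: "\<xi> k \<in> measurable W P" "X k \<in> borel_measurable W"
    using k by (auto intro: measurable_sample measurable_X)
  have pair: "(\<lambda>\<omega>. (past k \<omega>, \<xi> k \<omega>)) \<in> measurable W (past_space k \<Otimes>\<^sub>M P)"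
    using past by measurable
  have sets[measurable_cong]: "sets \<mu> = sets (past_space k)" by (simp add: \<mu>_def)
  interpret \<mu>: prob_space \<mu> unfolding \<mu>_def by (rule W.prob_space_distr[OF past])
  interpret \<mu>P: pair_prob_space \<mu> P ..
  let ?F = "\<lambda>z. (gbar (A (fst z)) - g (A (fst z)) (snd z)) \<bullet> (A (fst z) - xstar)"
  have law: "\<mu> \<Otimes>\<^sub>M P = distr W (past_space k \<Otimes>\<^sub>M P) (\<lambda>\<omega>. (past k \<omega>, \<xi> k \<omega>))"
    unfolding \<mu>_def distr_past_sample[OF less_imp_le[OF k]] ..
  have F: "?F \<in> borel_measurable (past_space k \<Otimes>\<^sub>M P)" by measurable
  have eq: "noise k \<omega> \<bullet> (X k \<omega> - xstar) = ?F (past k \<omega>, \<xi> k \<omega>)" if "\<omega> \<in> space W" for \<omega>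
    using that by (simp add: Aeq)
  \<comment> \<open>Fubini for a signed integrand requires integrability on the product space,
    obtained here on \<open>W\<close> and transported by the law of past and sample.\<close>
  have "integrable W (\<lambda>\<omega>. noise k \<omega> \<bullet> (X k \<omega> - xstar))"
    using k by (intro noise_inner_integrable measurable_X X_edom xstar_edom borel_measurable_const) auto
  then have "integrable W (\<lambda>\<omega>. ?F (past k \<omega>, \<xi> k \<omega>))"
    by (simp only: eq cong: Bochner_Integration.integrable_cong)
  then have int: "integrable (\<mu> \<Otimes>\<^sub>M P) ?F"
    unfolding law by (simp only: integrable_distr_eq[OF pair F])
  have "(LINT \<omega>|W. noise k \<omega> \<bullet> (X k \<omega> - xstar)) = (LINT \<omega>|W. ?F (past k \<omega>, \<xi> k \<omega>))"
    by (intro Bochner_Integration.integral_cong refl eq)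
  also have "\<dots> = (LINT z|(\<mu> \<Otimes>\<^sub>M P). ?F z)"
    unfolding law by (rule integral_distr[OF pair F, symmetric])
  also have "\<dots> = (LINT h|\<mu>. LINT s|P. ?F (h, s))"
    by (rule \<mu>P.integral_fst'[OF int, symmetric])
  also have "\<dots> = (LINT h|\<mu>. 0)"
  proof (intro Bochner_Integration.integral_cong refl)
    fix h
    have "integrable P (g (A h))" "(LINT s|P. g (A h) s) = gbar (A h)"
      using unbiased by (auto simp: unbiased_def)
    then show "(LINT s|P. ?F (h, s)) = 0"
      by (simp add: P.prob_space)
  qed
  finally show ?thesis by simp
qed

text \<open>Monotonicity of the coefficients bounds the negative part of \<open>growth_gap\<close>
  by the noise and \<open>m k\<close>, both integrable by induction. The requirement then controls
  \<open>growth_gap\<close> itself, from which \<open>m (Suc k)\<close> is recovered.\<close>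

lemma m_integrable: "k \<le> N \<Longrightarrow> integrable W (m k)"
proof (induction k)
  case 0
  then show ?case using m_0 by (simp cong: Bochner_Integration.integrable_cong)
next
  case (Suc k)
  then have k: "k < N" and int: "integrable W (m k)" by auto
  have noise: "integrable W (\<lambda>\<omega>. noise k \<omega> \<bullet> (X (Suc k) \<omega> - X k \<omega>))"
    using k by (intro noise_inner_integrable measurable_X X_edom) auto
  have "integrable W (at_step growth_gap k)"
  proof (rule requirement_expectation(1)[OF k _ measurable_growth_gap growth_gap_le])
    \<comment> \<open>Only integrability is extracted, so any admissible \<open>Mbar\<close>
      serves.\<close>
    show "c2 * L < c2 * L + 1" by simp
    show "integrable W (\<lambda>\<omega>. \<bar>noise k \<omega> \<bullet> (X (Suc k) \<omega> - X k \<omega>)\<bar> + m k \<omega> * D\<^sup>2 / 2)"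
      using noise int by (intro Bochner_Integration.integrable_add integrable_abs) auto
    fix \<omega> assume \<omega>: "\<omega> \<in> space W"
    show "- at_step growth_gap k \<omega> \<le> \<bar>noise k \<omega> \<bullet> (X (Suc k) \<omega> - X k \<omega>)\<bar> + m k \<omega> * D\<^sup>2 / 2"
      using m_mono[OF k \<omega>] mult_right_mono[of "m k \<omega>" "m (Suc k) \<omega>" "D\<^sup>2"]
      unfolding growth_gap_def m_Suc[OF k \<omega>, symmetric] by (simp add: field_simps)
  qed
  \<comment> \<open>The definition of \<open>growth_gap\<close> is affine in the new coefficient
    with slope D^2 / 2; this is its solution for that coefficient.\<close>
  then have "integrable W (\<lambda>\<omega>. (at_step growth_gap k \<omega> - noise k \<omega> \<bullet> (X (Suc k) \<omega> - X k \<omega>)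
      + m k \<omega> * D\<^sup>2) * (2 / D\<^sup>2))"
    using noise int by (intro integrable_mult_left Bochner_Integration.integrable_add
        Bochner_Integration.integrable_diff) auto
  also have "?this \<longleftrightarrow> integrable W (m (Suc k))"
  proof (rule Bochner_Integration.integrable_cong[OF refl])
    fix \<omega> assume \<omega>: "\<omega> \<in> space W"
    show "(at_step growth_gap k \<omega> - noise k \<omega> \<bullet> (X (Suc k) \<omega> - X k \<omega>) + m k \<omega> * D\<^sup>2) * (2 / D\<^sup>2) = m (Suc k) \<omega>"
      unfolding growth_gap_def m_Suc[OF k \<omega>, symmetric] using D_pos by (simp add: field_simps)
  qed
  finally show ?case .
qed

section \<open>Expected suboptimality of one step and its summation\<close>

definition obj :: "real^'n \<Rightarrow> real" where
  "obj x = f x + psi_real x"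

lemma obj_xstar_le: "x \<in> edom \<psi> \<Longrightarrow> obj xstar \<le> obj x"
proof -
  assume x: "x \<in> edom \<psi>"
  then have "\<not> composite f \<psi> x < composite f \<psi> xstar" using xstar by (auto simp: is_arg_min_def)
  moreover obtain a b where "\<psi> x = ereal a" "\<psi> xstar = ereal b"
    using edom_real[OF closed_psi x] edom_real[OF closed_psi xstar_edom] by blast
  ultimately show ?thesis by (simp add: composite_def obj_def)
qed

lemma m_times_dist_integrable:
  assumes "k \<le> N"
  shows "integrable W (\<lambda>\<omega>. m k \<omega> / 2 * (bnorm B (xstar - X k \<omega>))\<^sup>2)"
proof (rule Bochner_Integration.integrable_bound)
  have [measurable]: "X k \<in> borel_measurable W" "m k \<in> borel_measurable W"
    using assms by (auto intro: measurable_X measurable_m)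
  show "integrable W (\<lambda>\<omega>. m k \<omega> / 2 * D\<^sup>2)" using m_integrable[OF assms] by simp
  show "(\<lambda>\<omega>. m k \<omega> / 2 * (bnorm B (xstar - X k \<omega>))\<^sup>2) \<in> borel_measurable W"
    by (intro borel_measurable_times borel_measurable_power measurable_compose[OF _ borel_measurable_bnorm]
        borel_measurable_diff borel_measurable_divide) auto
  show "AE \<omega> in W. norm (m k \<omega> / 2 * (bnorm B (xstar - X k \<omega>))\<^sup>2) \<le> norm (m k \<omega> / 2 * D\<^sup>2)"
    using bnorm_diff_sq_le[OF xstar_edom X_edom[OF assms]]
    by (intro AE_I2) (simp add: abs_mult mult_left_mono)
qed

text \<open>Optimality of \<open>xstar\<close> and nonnegativity of the new distance term leave only
  the noise and the old distance term in the negative part, so no integrability of the objective is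
  presupposed.\<close>

lemma descent_gap_integrable:
  assumes k: "k < N" and Mbar: "Mbar > c2 * L"
  shows "integrable W (at_step descent_gap k)"
    and "(LINT \<omega>|W. at_step descent_gap k \<omega>) \<le> (LINT \<omega>|W. at_step (req_rhs Mbar) k \<omega>)"
proof -
  let ?V = "\<lambda>\<omega>. \<bar>noise k \<omega> \<bullet> (X k \<omega> - xstar)\<bar> + m k \<omega> / 2 * (bnorm B (xstar - X k \<omega>))\<^sup>2"
  have V: "integrable W ?V"
    using k by (intro Bochner_Integration.integrable_add integrable_abs m_times_dist_integrable noise_inner_integrable
        measurable_X X_edom xstar_edom borel_measurable_const) auto
  have "- at_step descent_gap k \<omega> \<le> ?V \<omega>" if \<omega>: "\<omega> \<in> space W" for \<omega>
  proof -
    have "obj xstar \<le> obj (X (Suc k) \<omega>)" using k \<omega> by (intro obj_xstar_le X_edom) auto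
    moreover have "0 \<le> m (Suc k) \<omega> / 2 * (bnorm B (xstar - X (Suc k) \<omega>))\<^sup>2"
      using m_nonneg[of "Suc k" \<omega>] k \<omega> by simp
    ultimately show ?thesis
      unfolding descent_gap_def m_Suc[OF k \<omega>, symmetric] obj_def[symmetric] by linarith
  qed
  from requirement_expectation[OF k Mbar measurable_descent_gap descent_gap_le V this]
  show "integrable W (at_step descent_gap k)"
    "(LINT \<omega>|W. at_step descent_gap k \<omega>) \<le> (LINT \<omega>|W. at_step (req_rhs Mbar) k \<omega>)" by auto
qed

lemma obj_eq_descent_gap:
  assumes k: "k < N" and \<omega>: "\<omega> \<in> space W"
  shows "obj (X (Suc k) \<omega>) = at_step descent_gap k \<omega> + obj xstar + noise k \<omega> \<bullet> (X k \<omega> - xstar)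
    + (m k \<omega> / 2 * (bnorm B (xstar - X k \<omega>))\<^sup>2 - m (Suc k) \<omega> / 2 * (bnorm B (xstar - X (Suc k) \<omega>))\<^sup>2)"
  unfolding descent_gap_def m_Suc[OF k \<omega>, symmetric] obj_def by simp

text \<open>Although the domain is bounded, \<open>\<psi>\<close> may be unbounded on it.
  Integrability is read off from \<open>obj_eq_descent_gap\<close>, where every term on the right is
  already integrable.\<close>

lemma obj_integrable:
  assumes k: "k < N"
  shows "integrable W (\<lambda>\<omega>. obj (X (Suc k) \<omega>))"
proof -
  have gt: "c2 * L < c2 * L + 1" by simp
  have "integrable W (\<lambda>\<omega>. at_step descent_gap k \<omega> + obj xstar + noise k \<omega> \<bullet> (X k \<omega> - xstar)
    + (m k \<omega> / 2 * (bnorm B (xstar - X k \<omega>))\<^sup>2 - m (Suc k) \<omega> / 2 * (bnorm B (xstar - X (Suc k) \<omega>))\<^sup>2))"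
    using k by (intro Bochner_Integration.integrable_add Bochner_Integration.integrable_diff
        descent_gap_integrable(1)[OF k gt] m_times_dist_integrable noise_inner_integrable
        measurable_X X_edom xstar_edom borel_measurable_const) auto
  then show ?thesis by (simp only: obj_eq_descent_gap[OF k] cong: Bochner_Integration.integrable_cong)
qed

text \<open>By monotonicity of the coefficients, each truncated increment is the increment of
  \<open>min (m k \<omega>) M\<close>; both vanish once \<open>m k \<omega>\<close> has passed
  \<open>M\<close>. The telescoping sum starts from \<open>m 0 \<omega> = 0\<close>.\<close>

lemma sum_truncated_increments_le:
  assumes \<omega>: "\<omega> \<in> space W" and M: "0 \<le> M"
  shows "(\<Sum>k<N. max 0 (min (m (Suc k) \<omega>) M - m k \<omega>)) \<le> M"
proof -
  have "(\<Sum>k<N. max 0 (min (m (Suc k) \<omega>) M - m k \<omega>)) \<le> (\<Sum>k<N. min (m (Suc k) \<omega>) M - min (m k \<omega>) M)"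
    using m_mono[OF _ \<omega>] by (intro sum_mono) (auto simp: max_def min_def)
  also have "\<dots> = min (m N \<omega>) M - min (m 0 \<omega>) M" by (rule sum_lessThan_telescope)
  also have "\<dots> \<le> M" using M by (simp add: m_0[OF \<omega>])
  finally show ?thesis .
qed

text \<open>The noise has mean zero and the distance terms cancel in pairs, leaving a first one that
  vanishes and a last one that may be dropped for its sign. The constant part of the requirement is
  paid once per step, the truncated increments only once in total.\<close>

lemma sum_obj_expectation_le:
  assumes Mbar: "Mbar > c2 * L"
  shows "(LINT \<omega>|W. (\<Sum>i=1..N. obj (X i \<omega>)) / real N) - obj xstar
    \<le> c1 / (Mbar - c2 * L) * (2 * \<sigma>\<^sup>2) + c3 * \<delta> + c4 * Mbar * D\<^sup>2 / real N"
proof -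
  let ?K = "c1 / (Mbar - c2 * L) * (2 * \<sigma>\<^sup>2) + c3 * \<delta>"
  let ?d = "\<lambda>k \<omega>. m k \<omega> / 2 * (bnorm B (xstar - X k \<omega>))\<^sup>2"
  have M0: "0 \<le> Mbar" using Mbar mult_nonneg_nonneg[OF less_imp_le[OF c_pos(2)] L_nonneg] by linarith
  have noise: "integrable W (\<lambda>\<omega>. noise k \<omega> \<bullet> (X k \<omega> - xstar))" if "k < N" for k
    using that by (intro noise_inner_integrable measurable_X X_edom xstar_edom borel_measurable_const) auto
  have dN: "0 \<le> (LINT \<omega>|W. ?d N \<omega>)"
  proof (rule Bochner_Integration.integral_nonneg)
    fix \<omega> assume "\<omega> \<in> space W"
    then have "0 \<le> m N \<omega>" by (intro m_nonneg) auto
    then show "0 \<le> ?d N \<omega>" by simp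
  qed
  note ints = descent_gap_integrable(1)[OF _ Mbar] noise m_times_dist_integrable req_rhs_integrable[OF _ Mbar]
  have "(LINT \<omega>|W. (\<Sum>k<N. obj (X (Suc k) \<omega>))) = (\<Sum>k<N. LINT \<omega>|W. obj (X (Suc k) \<omega>))"
    using obj_integrable by (intro Bochner_Integration.integral_sum) auto
  also have "\<dots> \<le> (\<Sum>k<N. (LINT \<omega>|W. at_step (req_rhs Mbar) k \<omega>) + obj xstar
      + ((LINT \<omega>|W. ?d k \<omega>) - (LINT \<omega>|W. ?d (Suc k) \<omega>)))"
  proof (rule sum_mono)
    fix k assume "k \<in> {..<N}"
    then have k: "k < N" by simp
    have "(LINT \<omega>|W. obj (X (Suc k) \<omega>)) = (LINT \<omega>|W. at_step descent_gap k \<omega> + obj xstar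
        + noise k \<omega> \<bullet> (X k \<omega> - xstar) + (?d k \<omega> - ?d (Suc k) \<omega>))"
      by (intro Bochner_Integration.integral_cong refl obj_eq_descent_gap[OF k])
    also have "\<dots> = (LINT \<omega>|W. at_step descent_gap k \<omega>) + obj xstar
        + (LINT \<omega>|W. noise k \<omega> \<bullet> (X k \<omega> - xstar)) + ((LINT \<omega>|W. ?d k \<omega>) - (LINT \<omega>|W. ?d (Suc k) \<omega>))"
      using ints[of k] m_times_dist_integrable[of "Suc k"] k
      by (simp add: W.prob_space del: times_divide_eq_left)
    finally show "(LINT \<omega>|W. obj (X (Suc k) \<omega>)) \<le> (LINT \<omega>|W. at_step (req_rhs Mbar) k \<omega>) + obj xstar
      + ((LINT \<omega>|W. ?d k \<omega>) - (LINT \<omega>|W. ?d (Suc k) \<omega>))"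
      using noise_expectation[OF k] descent_gap_integrable(2)[OF k Mbar] by simp
  qed
  also have "\<dots> = (LINT \<omega>|W. (\<Sum>k<N. at_step (req_rhs Mbar) k \<omega>)) + real N * obj xstar
      + ((LINT \<omega>|W. ?d 0 \<omega>) - (LINT \<omega>|W. ?d N \<omega>))"
    using ints(4)
    by (simp add: sum.distrib sum_lessThan_telescope'[of "\<lambda>k. LINT \<omega>|W. ?d k \<omega>"] Bochner_Integration.integral_sum
        del: times_divide_eq_left)
  \<comment> \<open>The start with coefficient zero removes the initial distance from the
    bound.\<close>
  also have "(LINT \<omega>|W. ?d 0 \<omega>) = (LINT \<omega>|W. 0)"
    by (intro Bochner_Integration.integral_cong refl) (simp add: m_0)
  \<comment> \<open>The sum is taken inside the expectation because the increments telescope along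
    each trajectory; a bound step by step would lose a factor \<open>N\<close>.\<close>
  also have "(LINT \<omega>|W. (\<Sum>k<N. at_step (req_rhs Mbar) k \<omega>)) \<le> (LINT \<omega>|W. real N * ?K + c4 * Mbar * D\<^sup>2)"
  proof (rule integral_mono)
    show "integrable W (\<lambda>\<omega>. \<Sum>k<N. at_step (req_rhs Mbar) k \<omega>)" using ints(4) by auto
    fix \<omega> assume \<omega>: "\<omega> \<in> space W"
    have "(\<Sum>k<N. at_step (req_rhs Mbar) k \<omega>)
        = (\<Sum>k<N. ?K + c4 * D\<^sup>2 * max 0 (min (m (Suc k) \<omega>) Mbar - m k \<omega>))"
      by (intro sum.cong refl) (simp add: req_rhs_def m_Suc[OF _ \<omega>])
    also have "\<dots> = real N * ?K + c4 * D\<^sup>2 * (\<Sum>k<N. max 0 (min (m (Suc k) \<omega>) Mbar - m k \<omega>))"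
      by (simp add: sum.distrib sum_distrib_left)
    also have "\<dots> \<le> real N * ?K + c4 * D\<^sup>2 * Mbar"
      using c_pos by (intro add_left_mono mult_left_mono sum_truncated_increments_le[OF \<omega> M0]) auto
    finally show "(\<Sum>k<N. at_step (req_rhs Mbar) k \<omega>) \<le> real N * ?K + c4 * Mbar * D\<^sup>2" by (simp add: mult_ac)
  qed simp
  also have "(LINT \<omega>|W. real N * ?K + c4 * Mbar * D\<^sup>2) = real N * ?K + c4 * Mbar * D\<^sup>2"
    by (simp add: W.prob_space)
  finally have "(LINT \<omega>|W. (\<Sum>k<N. obj (X (Suc k) \<omega>))) \<le> real N * (?K + obj xstar) + c4 * Mbar * D\<^sup>2"
    using dN by (simp add: algebra_simps)
  then have "(LINT \<omega>|W. (\<Sum>k<N. obj (X (Suc k) \<omega>))) / real N \<le> ?K + obj xstar + c4 * Mbar * D\<^sup>2 / real N"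
    using N_pos by (simp add: field_simps)
  \<comment> \<open>The output averages the iterates 1 to \<open>N\<close>, that is, the end points
    of the steps 0 to \<open>N - 1\<close>.\<close>
  moreover have "(\<Sum>i=1..N. obj (X i \<omega>)) = (\<Sum>k<N. obj (X (Suc k) \<omega>))" for \<omega>
    by (simp add: sum.atLeast1_atMost_eq)
  ultimately show ?thesis by simp
qed

end

text \<open>The two terms depending on \<open>\<tau>\<close>, one decreasing and one increasing, are
  balanced. For \<open>\<sigma> = 0\<close> the balancing value would be 0, which is not admissible,
  and the bound is obtained by letting \<open>\<tau>\<close> shrink.\<close>

lemma bound_by_optimal_parameter:
  fixes E \<sigma> D c1 c4 a b n :: real
  assumes pos: "D > 0" "c1 > 0" "c4 > 0" "n > 0" "\<sigma> \<ge> 0"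
    and bound: "\<And>\<tau>. \<tau> > 0 \<Longrightarrow> E \<le> c1 / \<tau> * (2 * \<sigma>\<^sup>2) + b + c4 * (a + \<tau>) * D\<^sup>2 / n"
  shows "E \<le> a * c4 * D\<^sup>2 / n + 2 * \<sigma> * D * sqrt (2 * c1 * c4 / n) + b"
proof (cases "\<sigma> = 0")
  case True
  have "E \<le> a * c4 * D\<^sup>2 / n + b + e" if "e > 0" for e
  proof -
    \<comment> \<open>Chosen so that the term linear in \<open>\<tau>\<close> contributes exactly
      \<open>e\<close>.\<close>
    let ?\<tau> = "e * n / (c4 * D\<^sup>2)"
    have "?\<tau> > 0" using pos that by simp
    moreover have "c4 * (a + ?\<tau>) * D\<^sup>2 / n = a * c4 * D\<^sup>2 / n + e"
      using pos by (simp add: field_simps)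
    ultimately show ?thesis using bound[of ?\<tau>] True by simp
  qed
  then have "E \<le> a * c4 * D\<^sup>2 / n + b" by (rule field_le_epsilon)
  then show ?thesis using True by simp
next
  case False
  define q where "q = sqrt (2 * c1 * c4 / n)"
  have q: "q > 0" and q2: "q * q = 2 * c1 * c4 / n" using pos by (simp_all add: q_def)
  \<comment> \<open>Solution of 2 c1 \<sigma>^2 / \<tau> = c4 \<tau> D^2 / n. Both terms then equal
    \<open>\<sigma> * D * q\<close>, whence the factor 2 in the rate.\<close>
  let ?\<tau> = "\<sigma> * q * n / (c4 * D)"
  have \<tau>: "?\<tau> > 0" using pos q False by simp
  have "c1 / ?\<tau> * (2 * \<sigma>\<^sup>2) = \<sigma> * D * ((2 * c1 * c4 / n) / q)"
    using pos False q by (simp add: divide_simps power2_eq_square)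
  also have "\<dots> = \<sigma> * D * q" using q by (simp add: q2[symmetric])
  finally have "c1 / ?\<tau> * (2 * \<sigma>\<^sup>2) = \<sigma> * D * q" .
  moreover have "c4 * (a + ?\<tau>) * D\<^sup>2 / n = a * c4 * D\<^sup>2 / n + \<sigma> * D * q"
    using pos by (simp add: field_simps power2_eq_square)
  ultimately show ?thesis using bound[OF \<tau>] unfolding q_def[symmetric] by linarith
qed

theorem theorem4:
  fixes B :: "real^'n^'n"
    and f fbar :: "real^'n \<Rightarrow> real"
    and gbar :: "real^'n \<Rightarrow> real^'n"
    and \<psi> :: "real^'n \<Rightarrow> ereal"
    and P :: "'s measure"
    and g :: "real^'n \<Rightarrow> 's \<Rightarrow> real^'n"
    and upd :: "'n stepsize_rule"
    and W :: "'w measure"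
    and \<xi> :: "nat \<Rightarrow> 'w \<Rightarrow> 's"
    and X :: "nat \<Rightarrow> 'w \<Rightarrow> real^'n"
    and m :: "nat \<Rightarrow> 'w \<Rightarrow> real"
    and x0 xstar :: "real^'n"
    and \<delta> L D \<sigma> c1 c2 c3 c4 :: real
    and N :: nat
  assumes "pos_def_matrix B"
    and "convex_on UNIV f"
    and "proper_closed_convex \<psi>"
    and "is_arg_min (composite f \<psi>) (\<lambda>x. x \<in> edom \<psi>) xstar"
    and "approx_smooth B \<delta> L f fbar gbar"
    and "D > 0"
    and "\<forall>x\<in>edom \<psi>. \<forall>y\<in>edom \<psi>. bnorm B (x - y) \<le> D"
    and "stoch_oracle P g"
    and "unbiased P g gbar"
    and "\<sigma> \<ge> 0"
    and "ereal (\<sigma>\<^sup>2) = (SUP x\<in>edom \<psi>. oracle_var B P g gbar x)"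
    and "c1 > 0" and "c2 > 0" and "c3 > 0" and "c4 > 0"
    and "stepsize_requirement B \<psi> f fbar gbar \<delta> L P g c1 c2 c3 c4 upd"
    and "N \<ge> 1"
    and "x0 \<in> edom \<psi>"
    and "universal_sgd B \<psi> P g upd W \<xi> x0 0 N D X m"
  shows "ext_expectation W (\<lambda>\<omega>. composite f \<psi> (avg_iterate X N \<omega>)) - composite f \<psi> xstar
         \<le> ereal (c2 * c4 * L * D\<^sup>2 / real N
                  + 2 * \<sigma> * D * sqrt (2 * c1 * c4 / real N) + c3 * \<delta>)"
proof -
  interpret sgd_run B f fbar gbar \<psi> P g upd xstar \<delta> L D \<sigma> c1 c2 c3 c4 W \<xi> X m x0 N
    by unfold_locales (fact assms)+
  let ?avg = "\<lambda>\<omega>. (\<Sum>i=1..N. obj (X i \<omega>)) / real N"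
  have "integrable W (\<lambda>\<omega>. obj (X i \<omega>))" if "i \<in> {1..N}" for i
    using obj_integrable[of "i - 1"] that by (cases i) auto
  then have int: "integrable W ?avg"
    by (intro integrable_divide Bochner_Integration.integrable_sum)
  \<comment> \<open>Jensen's inequality holds on every trajectory, so the extended expectation of
    the averaged point is bounded by that of an integrable real function.\<close>
  have "ext_expectation W (\<lambda>\<omega>. composite f \<psi> (avg_iterate X N \<omega>)) \<le> ext_expectation W (\<lambda>\<omega>. ereal (?avg \<omega>))"
    unfolding obj_def using N_pos X_edom
    by (intro ext_expectation_mono_AE AE_I2 composite_average_le closed_psi convex_f) auto
  also have "\<dots> = ereal (LINT \<omega>|W. ?avg \<omega>)" by (rule ext_expectation_integral[OF int])
  finally have "ext_expectation W (\<lambda>\<omega>. composite f \<psi> (avg_iterate X N \<omega>)) - composite f \<psi> xstar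
      \<le> ereal (LINT \<omega>|W. ?avg \<omega>) - composite f \<psi> xstar"
    by (rule ereal_minus_mono) simp
  also have "\<dots> = ereal (LINT \<omega>|W. ?avg \<omega>) - ereal (obj xstar)"
    unfolding composite_def obj_def by (subst edom_real[OF closed_psi xstar_edom]) simp
  \<comment> \<open>The parameter \<open>\<tau>\<close> is the distance of \<open>Mbar\<close> from
    the threshold \<open>c2 * L\<close>; the threshold itself produces the term of order 1 /
    N.\<close>
  also have "\<dots> \<le> ereal ((c2 * L) * c4 * D\<^sup>2 / real N + 2 * \<sigma> * D * sqrt (2 * c1 * c4 / real N) + c3 * \<delta>)"
    unfolding ereal_minus ereal_less_eq
  proof (rule bound_by_optimal_parameter[OF D_pos c_pos(1) c_pos(4) _ \<open>\<sigma> \<ge> 0\<close>])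
    fix \<tau> :: real assume "\<tau> > 0"
    then show "(LINT \<omega>|W. ?avg \<omega>) - obj xstar
        \<le> c1 / \<tau> * (2 * \<sigma>\<^sup>2) + c3 * \<delta> + c4 * (c2 * L + \<tau>) * D\<^sup>2 / real N"
      using sum_obj_expectation_le[of "c2 * L + \<tau>"] by simp
  qed (use N_pos in simp)
  finally show ?thesis by (simp add: mult_ac)
qed

end
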